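(* Fix an integer $m\geq 2$ and a function $\omega\colon \mathbb{N}\to\mathbb{R}$ such that $\lim_{n\to\infty}\omega(n)=\infty$. Let $r=r(n)\geq 1$ be a sequence of integers. For each $n\ge 1$, let $\mathcal C_r$ be a set of $r=r(n)$ colors, and let $\chi_1,\ldots,\chi_m\colon\binom{[n]}{2}\to\mathcal C_r$ be independent uniformly random functions ($r$-edge-colorings of the complete graph $K_n$). (i) If $$r\leq \frac{m\binom{n}{2}}{2\log(n!)}-\frac{\omega(n)}{(\log n)^2}$$ for all $n\ge 2$, then with high probability, there does not exist a rainbow stacking of $\chi_1,\ldots,\chi_m$. (ii) If $$r\geq \frac{m\binom{n}{2}}{2\log(n!)}+\frac{2m-1}{3}+\frac{m}{2\log n}+\frac{\omega(n)}{(\log n)^2}$$ for all $n\ge 2$, then with high probability, there exists a rainbow stacking of $\chi_1,\ldots,\chi_m$.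
   Context: $[n]=\{1,\ldots,n\}$, $\mathfrak S_n$ is the symmetric group on $[n]$, $K_n$ is the complete graph with vertex set $[n]$ and edge set $\binom{[n]}{2}$ (the set of $2$-element subsets of $[n]$), and $\log$ is the natural logarithm. For $\sigma\in\mathfrak S_n$ and $e=\{i,j\}\in\binom{[n]}{2}$, write $\sigma^{-1}(e)=\{\sigma^{-1}(i),\sigma^{-1}(j)\}$. Given colorings $\chi_1,\ldots,\chi_m\colon\binom{[n]}{2}\to\mathcal C_r$ (not required to be proper), a rainbow stacking of $\chi_1,\ldots,\chi_m$ is a tuple $(\sigma_1,\ldots,\sigma_m)\in\mathfrak S_n^m$ such that for each edge $e\in\binom{[n]}{2}$, the colors $\chi_1(\sigma_1^{-1}(e)),\ldots,\chi_m(\sigma_m^{-1}(e))$ are all distinct. "With high probability" means with probability tending to $1$ as $n\to\infty$. *)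

theory Defs
  imports "HOL-Probability.Probability" "HOL-Library.Ramsey"
begin

definition K_edges :: "nat \<Rightarrow> nat set set" where
  "K_edges n = nsets {1..n} 2"

text \<open>Colorings are extensional functions on the edge set: they take the value \<open>undefined\<close>
  outside of it, so that the set of all colorings is finite.\<close>

definition edge_colorings :: "nat \<Rightarrow> 'c set \<Rightarrow> (nat set \<Rightarrow> 'c) set" where
  "edge_colorings n C = K_edges n \<rightarrow>\<^sub>E C"

text \<open>\<open>Pi_pmf\<close> makes the components with index in \<open>{1..m}\<close> independent; its second argument is only
  the value of the components outside of \<open>{1..m}\<close>.\<close>

definition random_colorings :: "nat \<Rightarrow> nat \<Rightarrow> 'c set \<Rightarrow> (nat \<Rightarrow> nat set \<Rightarrow> 'c) pmf" where
  "random_colorings m n C = Pi_pmf {1..m} undefined (\<lambda>_. pmf_of_set (edge_colorings n C))"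

definition rainbow_stacking ::
    "nat \<Rightarrow> nat \<Rightarrow> (nat \<Rightarrow> nat set \<Rightarrow> 'c) \<Rightarrow> (nat \<Rightarrow> nat \<Rightarrow> nat) \<Rightarrow> bool" where
  "rainbow_stacking m n \<kappa> \<sigma> \<longleftrightarrow>
     \<sigma> \<in> {1..m} \<rightarrow>\<^sub>E {p. p permutes {1..n}} \<and>
     (\<forall>e\<in>K_edges n. inj_on (\<lambda>i. \<kappa> i (inv (\<sigma> i) ` e)) {1..m})"

definition with_high_probability :: "(nat \<Rightarrow> 'a pmf) \<Rightarrow> (nat \<Rightarrow> 'a \<Rightarrow> bool) \<Rightarrow> bool" where
  "with_high_probability p E \<longleftrightarrow>
     (\<lambda>n. measure_pmf.prob (p n) {x. E n x}) \<longlonglongrightarrow> 1"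

end

theory Submission
  imports Defs "HOL-Real_Asymp.Real_Asymp"
begin

text \<open>
  Write \<open>N = n choose 2\<close> and \<open>r\<^sub>0 = m * N / (2 * ln n!)\<close>. Part (i) is a union bound over the
  \<open>n! ^ (m - 1)\<close> stackings whose first coordinate is the identity.

  Part (ii) is a second moment argument. That two given stackings are both rainbow means that a
  random coloring of \<open>m * N\<close> vertices is proper for a certain graph, in which the earlier neighbors
  of each vertex form two cliques of equal size \<open>a\<close> with some number \<open>d\<close> of common vertices. Adding
  the vertices one at a time, each contributes at most \<open>(r - a)\<^sup>2 / (r * (r - d)) * (1 + O(1 / r ^ 3))\<close>
  to the probability, since nonadjacent vertices of a random proper coloring share their color with
  probability at most \<open>1 / (r - O(1))\<close>. As \<open>N / r ^ 3\<close> tends to \<open>0\<close>, the correlation of two stackings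
  is at most \<open>1 + o(1)\<close> times \<open>exp\<close> of a multiple of \<open>F\<close>, where \<open>F\<close> counts the pairs of coordinates
  and edges on which the two stackings have the same relative position. By convexity, the average of
  this over all stackings is bounded by a power of the exponential moment of the number of edges
  fixed by a single random permutation, and that moment tends to \<open>1\<close>.
\<close>

text \<open>The lower-order terms decide everything. Near the threshold \<open>r\<close> is of order
  \<open>n / ln n\<close>, so \<open>N / r ^ 2\<close> is of order \<open>(ln n) ^ 2\<close>, while
  \<open>N / r ^ 3\<close> is of order \<open>(ln n) ^ 3 / n\<close>. Hence the factor of each added
  vertex has to be correct up to a relative error of order \<open>1 / r ^ 3\<close>. The extreme
  pairs are those with \<open>\<sigma>' i = \<pi> \<circ> \<sigma> i\<close> for one
  \<open>\<pi>\<close> and all \<open>i\<close>: both stackings are rainbow for the same colorings,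
  and such pairs make up a fraction \<open>(n!) ^ (1 - m)\<close> of all pairs. For them all
  spanning stars carry the same weight, so the convexity step loses nothing, and they correspond to
  the identity in the moment of a single permutation. This leads to the requirement
  \<open>\<beta> * N < ln n!\<close> for
  \<open>\<beta> = m / 4 * (1 / r + 1 / (r - (m - 1)))\<close>. With
  \<open>r = r\<^sub>0 + \<delta>\<close> it says, to first order,
  \<open>\<delta> > (m - 1) / 2\<close>. The shift \<open>(2 * m - 1) / 3\<close> exceeds this by
  \<open>(m + 1) / 6\<close>, which lowers \<open>\<beta> * N\<close> by an amount of order
  \<open>(ln n) ^ 2\<close>, more than the \<open>3 * ln n\<close> that the moment bound asks
  for.\<close>

section \<open>Counting proper colorings one vertex at a time\<close>

definition proper_colorings :: "('v \<Rightarrow> 'v \<Rightarrow> bool) \<Rightarrow> 'v set \<Rightarrow> 'c set \<Rightarrow> ('v \<Rightarrow> 'c) set" where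
  "proper_colorings adj V C = {\<kappa> \<in> V \<rightarrow>\<^sub>E C. \<forall>u\<in>V. \<forall>w\<in>V. adj u w \<longrightarrow> \<kappa> u \<noteq> \<kappa> w}"

lemma proper_coloringsD:
  assumes "\<kappa> \<in> proper_colorings adj V C"
  shows "\<kappa> \<in> V \<rightarrow>\<^sub>E C" "\<And>u w. \<lbrakk>u \<in> V; w \<in> V; adj u w\<rbrakk> \<Longrightarrow> \<kappa> u \<noteq> \<kappa> w"
  using assms unfolding proper_colorings_def by auto

lemma finite_proper_colorings: "\<lbrakk>finite V; finite C\<rbrakk> \<Longrightarrow> finite (proper_colorings adj V C)"
  unfolding proper_colorings_def by (rule finite_subset[OF _ finite_PiE[of V "\<lambda>_. C"]]) auto

lemma card_proper_colorings_insert: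
  assumes sym: "symp adj" and irr: "\<not> adj v v" and fin: "finite V" "finite C" and v: "v \<notin> V"
  shows "card (proper_colorings adj (insert v V) C)
         = (\<Sum>\<kappa>\<in>proper_colorings adj V C. card (C - \<kappa> ` {w\<in>V. adj v w}))"
proof -
  let ?S = "SIGMA \<kappa>:proper_colorings adj V C. C - \<kappa> ` {w\<in>V. adj v w}"
  have "bij_betw (\<lambda>(\<kappa>, c). \<kappa>(v := c)) ?S (proper_colorings adj (insert v V) C)"
  proof (rule bij_betw_byWitness[where f' = "\<lambda>\<kappa>. (\<kappa>(v := undefined), \<kappa> v)"])
    show "\<forall>p\<in>?S. (\<lambda>\<kappa>. (\<kappa>(v := undefined), \<kappa> v)) (case p of (\<kappa>, c) \<Rightarrow> \<kappa>(v := c)) = p"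
      using v by (auto simp: proper_colorings_def PiE_def extensional_def)
    show "\<forall>\<kappa>\<in>proper_colorings adj (insert v V) C.
            (case (\<kappa>(v := undefined), \<kappa> v) of (\<kappa>, c) \<Rightarrow> \<kappa>(v := c)) = \<kappa>"
      by auto
    show "(\<lambda>(\<kappa>, c). \<kappa>(v := c)) ` ?S \<subseteq> proper_colorings adj (insert v V) C"
    proof safe
      fix \<kappa> c assume k: "\<kappa> \<in> proper_colorings adj V C" and c: "c \<in> C" "c \<notin> \<kappa> ` {w\<in>V. adj v w}"
      note kk = proper_coloringsD[OF k]
      have "c \<noteq> \<kappa> w" if "w \<in> V" "adj v w \<or> adj w v" for w
        using c(2) that sympD[OF sym] by blast
      moreover have "\<kappa>(v := c) \<in> insert v V \<rightarrow>\<^sub>E C"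
        using kk(1) c(1) by (auto simp: PiE_def extensional_def)
      ultimately show "\<kappa>(v := c) \<in> proper_colorings adj (insert v V) C"
        using kk(2) v irr unfolding proper_colorings_def by auto
    qed
    show "(\<lambda>\<kappa>. (\<kappa>(v := undefined), \<kappa> v)) ` proper_colorings adj (insert v V) C \<subseteq> ?S"
    proof safe
      fix \<kappa> assume k: "\<kappa> \<in> proper_colorings adj (insert v V) C"
      note kk = proper_coloringsD[OF k]
      show "\<kappa>(v := undefined) \<in> proper_colorings adj V C"
        using kk v unfolding proper_colorings_def by (auto simp: PiE_def extensional_def)
      show "\<kappa> v \<in> C" using kk(1) by auto
      fix w assume "\<kappa> v = (\<kappa>(v := undefined)) w" "w \<in> V" "adj v w"
      then show False using kk(2)[of v w] v by (auto split: if_splits)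
    qed
  qed
  then have "card (proper_colorings adj (insert v V) C) = card ?S"
    by (simp add: bij_betw_same_card)
  also have "\<dots> = (\<Sum>\<kappa>\<in>proper_colorings adj V C. card (C - \<kappa> ` {w\<in>V. adj v w}))"
    using finite_proper_colorings[OF fin] fin by (simp add: card_SigmaI)
  finally show ?thesis .
qed

text \<open>Forgetting the color of \<open>u\<close> is injective on the colorings with
  \<open>\<kappa> u = \<kappa> w\<close>, while every proper coloring of \<open>V - {u}\<close>
  extends to \<open>u\<close> in at least \<open>card C - \<Delta>\<close> ways.\<close>

lemma card_coincidence_le:
  assumes sym: "symp adj" and irr: "irreflp adj" and fin: "finite V" "finite C"
    and uw: "u \<in> V" "w \<in> V" "u \<noteq> w" and deg: "card {x\<in>V. adj u x} \<le> \<Delta>"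
  shows "card {\<kappa> \<in> proper_colorings adj V C. \<kappa> u = \<kappa> w} * (card C - \<Delta>)
         \<le> card (proper_colorings adj V C)"
proof -
  define V' where "V' = V - {u}"
  have V: "V = insert u V'" "u \<notin> V'" "finite V'" and w: "w \<in> V'"
    using uw fin by (auto simp: V'_def)
  have nuu: "\<not> adj u u" using irr by (simp add: irreflpD)
  have "card {\<kappa> \<in> proper_colorings adj V C. \<kappa> u = \<kappa> w} \<le> card (proper_colorings adj V' C)"
  proof (rule card_inj_on_le[where f = "\<lambda>\<kappa>. \<kappa>(u := undefined)"])
    show "inj_on (\<lambda>\<kappa>. \<kappa>(u := undefined)) {\<kappa> \<in> proper_colorings adj V C. \<kappa> u = \<kappa> w}"
    proof (rule inj_onI)
      fix f g assume f: "f \<in> {\<kappa> \<in> proper_colorings adj V C. \<kappa> u = \<kappa> w}"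
        and g: "g \<in> {\<kappa> \<in> proper_colorings adj V C. \<kappa> u = \<kappa> w}"
        and eq: "f(u := undefined) = g(u := undefined)"
      have "f x = g x" if "x \<noteq> u" for x using fun_cong[OF eq, of x] that by simp
      moreover from this have "f u = g u" using f g uw(3) by auto
      ultimately show "f = g" by (metis ext)
    qed
    show "(\<lambda>\<kappa>. \<kappa>(u := undefined)) ` {\<kappa> \<in> proper_colorings adj V C. \<kappa> u = \<kappa> w}
          \<subseteq> proper_colorings adj V' C"
      using V(2) unfolding proper_colorings_def V(1)
      by (auto simp: PiE_def extensional_def split: if_splits)
    show "finite (proper_colorings adj V' C)" using V fin by (simp add: finite_proper_colorings)
  qed
  then have "card {\<kappa> \<in> proper_colorings adj V C. \<kappa> u = \<kappa> w} * (card C - \<Delta>)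
      \<le> (\<Sum>\<kappa>\<in>proper_colorings adj V' C. card C - \<Delta>)"
    by simp
  also have "\<dots> \<le> (\<Sum>\<kappa>\<in>proper_colorings adj V' C. card (C - \<kappa> ` {x\<in>V'. adj u x}))"
  proof (rule sum_mono)
    fix \<kappa> :: "'a \<Rightarrow> 'b"
    have "card (\<kappa> ` {x\<in>V'. adj u x}) \<le> card {x\<in>V'. adj u x}"
      using V(3) by (intro card_image_le) auto
    also have "\<dots> \<le> card {x\<in>V. adj u x}"
      using fin V by (intro card_mono) auto
    finally have "card C - \<Delta> \<le> card C - card (\<kappa> ` {x\<in>V'. adj u x})" using deg by simp
    also have "\<dots> \<le> card (C - \<kappa> ` {x\<in>V'. adj u x})"
      using V(3) by (intro diff_card_le_card_Diff) auto
    finally show "card C - \<Delta> \<le> card (C - \<kappa> ` {x\<in>V'. adj u x})" .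
  qed
  also have "\<dots> = card (proper_colorings adj V C)"
    unfolding V(1) using card_proper_colorings_insert[OF sym nuu V(3) fin(2) V(2)] by simp
  finally show ?thesis .
qed

text \<open>The neighborhood of the new vertex is a union of two cliques. Given the other colors, the color
  of a vertex of the old graph has at least \<open>card C - \<Delta>\<close> equally likely values; hence any two
  vertices of different cliques share their color with probability at most \<open>1 / (card C - \<Delta>)\<close>.\<close>

lemma card_proper_colorings_insert_two_cliques:
  assumes sym: "symp adj" and irr: "irreflp adj" and fin: "finite V" "finite C" and v: "v \<notin> V"
    and nb: "{w\<in>V. adj v w} = A \<union> B"
    and clA: "\<And>u w. \<lbrakk>u \<in> A; w \<in> A; u \<noteq> w\<rbrakk> \<Longrightarrow> adj u w"
    and clB: "\<And>u w. \<lbrakk>u \<in> B; w \<in> B; u \<noteq> w\<rbrakk> \<Longrightarrow> adj u w"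
    and cA: "card A = a" and cB: "card B = a" and d: "card (A \<inter> B) = d"
    and deg: "\<And>u. u \<in> V \<Longrightarrow> card {x\<in>V. adj u x} \<le> \<Delta>" and r: "card C = r" "\<Delta> < r"
  shows "real (card (proper_colorings adj (insert v V) C))
     \<le> real (card (proper_colorings adj V C))
        * (real r - 2 * real a + real d + (real a - real d)\<^sup>2 / (real r - real \<Delta>))"
proof -
  let ?P = "proper_colorings adj V C"
  have AB: "A \<subseteq> V" "B \<subseteq> V" using nb by auto
  then have finAB: "finite A" "finite B" using fin by (auto intro: finite_subset)
  have finP: "finite ?P" using fin by (rule finite_proper_colorings)
  have cAB: "card (A - B) = a - d" "card (B - A) = a - d" "d \<le> a"
    using cA cB d finAB card_Diff_subset_Int[of A B] card_Diff_subset_Int[of B A]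
      card_mono[of A "A \<inter> B"]
    by (auto simp: Int_commute)
  let ?Q = "(A - B) \<times> (B - A)"
  \<comment> \<open>Each clique shows \<open>a\<close> distinct colors, so the neighbors block
    \<open>2 * a\<close> colors minus those seen in both cliques. Such a color comes from a common
    vertex or from a coinciding pair in \<open>?Q\<close>; counting all these pairs can only
    overestimate.\<close>
  have main: "real (card (C - \<kappa> ` (A \<union> B)))
      \<le> real r - 2 * real a + real d + (\<Sum>(u,w)\<in>?Q. of_bool (\<kappa> u = \<kappa> w))"
    if k: "\<kappa> \<in> ?P" for \<kappa>
  proof -
    note kk = proper_coloringsD[OF k]
    have "inj_on \<kappa> A" "inj_on \<kappa> B"
      using kk(2) clA clB AB unfolding inj_on_def by (meson subsetD)+
    then have c: "card (\<kappa> ` A) = a" "card (\<kappa> ` B) = a" using cA cB by (auto simp: card_image)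
    have sub: "\<kappa> ` (A \<union> B) \<subseteq> C" using kk(1) AB by (auto simp: PiE_def Pi_def)
    have cU: "card (\<kappa> ` (A \<union> B)) + card (\<kappa> ` A \<inter> \<kappa> ` B) = 2 * a"
      using card_Un_Int[of "\<kappa> ` A" "\<kappa> ` B"] finAB c by (simp add: image_Un)
    let ?M = "{p\<in>?Q. \<kappa> (fst p) = \<kappa> (snd p)}"
    have "\<kappa> ` A \<inter> \<kappa> ` B \<subseteq> \<kappa> ` (A \<inter> B) \<union> (\<lambda>p. \<kappa> (fst p)) ` ?M"
    proof
      fix x assume "x \<in> \<kappa> ` A \<inter> \<kappa> ` B"
      then obtain u w where uw: "u \<in> A" "w \<in> B" "x = \<kappa> u" "x = \<kappa> w" by auto
      show "x \<in> \<kappa> ` (A \<inter> B) \<union> (\<lambda>p. \<kappa> (fst p)) ` ?M"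
      proof (cases "u \<in> B \<or> w \<in> A")
        case True
        then show ?thesis using uw by blast
      next
        case False
        then have "(u, w) \<in> ?M" using uw by auto
        then show ?thesis using uw by force
      qed
    qed
    then have "card (\<kappa> ` A \<inter> \<kappa> ` B) \<le> card (\<kappa> ` (A \<inter> B) \<union> (\<lambda>p. \<kappa> (fst p)) ` ?M)"
      using finAB by (intro card_mono) auto
    also have "\<dots> \<le> card (\<kappa> ` (A \<inter> B)) + card ((\<lambda>p. \<kappa> (fst p)) ` ?M)" by (rule card_Un_le)
    also have "\<dots> \<le> d + card ?M"
      using finAB d by (intro add_mono) (auto intro!: card_image_le intro: le_trans[OF card_image_le])
    finally have I: "card (\<kappa> ` A \<inter> \<kappa> ` B) \<le> d + card ?M" .
    have Q: "?M = ?Q \<inter> {p. \<kappa> (fst p) = \<kappa> (snd p)}" by blast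
    have M: "real (card ?M) = (\<Sum>(u,w)\<in>?Q. of_bool (\<kappa> u = \<kappa> w))"
      unfolding Q using finAB by (simp add: case_prod_beta)
    have "card (C - \<kappa> ` (A \<union> B)) = r - card (\<kappa> ` (A \<union> B))"
      using sub finAB r by (subst card_Diff_subset) auto
    moreover have "card (\<kappa> ` (A \<union> B)) \<le> r" using sub fin r card_mono by blast
    ultimately show ?thesis using cU I unfolding M[symmetric] by linarith
  qed
  have coin: "(\<Sum>\<kappa>\<in>?P. of_bool (\<kappa> u = \<kappa> w)) \<le> real (card ?P) / (real r - real \<Delta>)"
    if "(u, w) \<in> ?Q" for u w
  proof -
    have "card {\<kappa> \<in> ?P. \<kappa> u = \<kappa> w} * (r - \<Delta>) \<le> card ?P"
      using card_coincidence_le[OF sym irr fin, of u w \<Delta>] deg[of u] that AB r by auto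
    then have "real (card {\<kappa> \<in> ?P. \<kappa> u = \<kappa> w} * (r - \<Delta>)) \<le> real (card ?P)"
      by (simp only: of_nat_le_iff)
    then have "real (card {\<kappa> \<in> ?P. \<kappa> u = \<kappa> w}) * (real r - real \<Delta>) \<le> real (card ?P)"
      using r by (simp add: of_nat_diff)
    moreover have "{\<kappa> \<in> ?P. \<kappa> u = \<kappa> w} = ?P \<inter> {\<kappa>. \<kappa> u = \<kappa> w}" by blast
    ultimately show ?thesis
      using r finP by (simp add: pos_le_divide_eq)
  qed
  have "real (card (proper_colorings adj (insert v V) C)) = (\<Sum>\<kappa>\<in>?P. real (card (C - \<kappa> ` (A \<union> B))))"
    using card_proper_colorings_insert[OF sym irreflpD[OF irr] fin v] nb by simp
  also have "\<dots> \<le> (\<Sum>\<kappa>\<in>?P. real r - 2 * real a + real d + (\<Sum>(u,w)\<in>?Q. of_bool (\<kappa> u = \<kappa> w)))"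
    using main by (rule sum_mono)
  also have "\<dots> = real (card ?P) * (real r - 2 * real a + real d)
      + (\<Sum>(u,w)\<in>?Q. \<Sum>\<kappa>\<in>?P. of_bool (\<kappa> u = \<kappa> w))"
    using sum.swap[of "\<lambda>\<kappa> (u, w). of_bool (\<kappa> u = \<kappa> w) :: real" ?Q ?P]
    by (simp add: sum.distrib sum_subtractf case_prod_beta algebra_simps)
  also have "\<dots> \<le> real (card ?P) * (real r - 2 * real a + real d)
      + (\<Sum>(u,w)\<in>?Q. real (card ?P) / (real r - real \<Delta>))"
    using coin by (intro add_left_mono sum_mono) auto
  also have "(\<Sum>(u,w)\<in>?Q. real (card ?P) / (real r - real \<Delta>))
      = (real a - real d)\<^sup>2 * (real (card ?P) / (real r - real \<Delta>))"
    using cAB by (simp add: card_cartesian_product power2_eq_square of_nat_diff)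
  finally show ?thesis by (simp add: algebra_simps)
qed

section \<open>Superimposing two stackings\<close>

text \<open>The trapezoidal rule overestimates the integral of the convex function
  \<open>1 / t\<close> over \<open>[r - d, r]\<close>; here this is \<open>s \<le> sinh s\<close>
  for \<open>exp s = r / (r - d)\<close>. The cruder bound \<open>d / (r - d)\<close> would raise
  the shift required in part (ii) from about \<open>(m - 1) / 2\<close> to about
  \<open>m - 1\<close>.\<close>

lemma ln_quotient_le:
  fixes r d :: real
  assumes "0 \<le> d" "d < r"
  shows "ln (r / (r - d)) \<le> d / 2 * (1 / r + 1 / (r - d))"
proof -
  have pos: "r > 0" "r - d > 0" using assms by auto
  define s where "s = ln (r / (r - d))"
  have "exp s = r / (r - d)" using pos unfolding s_def by simp
  moreover have "0 \<le> s" unfolding s_def using pos assms by (intro ln_ge_zero) (simp add: field_simps)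
  ultimately have "s \<le> (r / (r - d) - (r - d) / r) / 2"
    using real_le_x_sinh[of s] by (simp add: inverse_eq_divide)
  also have "\<dots> = d / 2 * (1 / r + 1 / (r - d))"
    using pos by (simp add: field_simps power2_eq_square)
  finally show ?thesis unfolding s_def .
qed

text \<open>With \<open>r - d\<close> in place of the denominator \<open>r - 2 * m\<close>, the left
  side is exactly \<open>(r - k)\<^sup>2 / (r - d)\<close>, and the replacement costs a relative
  error of order \<open>1 / r ^ 3\<close>. Two independent stackings would contribute
  \<open>(r - k)\<^sup>2 / r\<close>, so the exponential measures the correlation.\<close>

lemma two_clique_factor_le:
  fixes r k d m :: real
  assumes "0 \<le> d" "d \<le> k" "k \<le> m - 1" "2 * m < r"
  shows "r - 2 * k + d + (k - d)\<^sup>2 / (r - 2 * m)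
         \<le> (r - k)\<^sup>2 / r * exp (d * ((1 / r + 1 / (r - (m - 1))) / 2) + 2 * m ^ 3 / (r - 2 * m) ^ 3)"
proof -
  define \<epsilon> where "\<epsilon> = 2 * m ^ 3 / (r - 2 * m) ^ 3"
  have pos: "r > 0" "r - d > 0" "r - 2 * m > 0" "r - k > 0" "m > 0" using assms by auto
  have k2: "(k - d)\<^sup>2 \<le> m\<^sup>2" using assms by (intro power_mono) auto
  have "(k - d)\<^sup>2 / (r - 2 * m) = (k - d)\<^sup>2 / (r - d) + (k - d)\<^sup>2 * (2 * m - d) / ((r - 2 * m) * (r - d))"
    using pos by (simp add: divide_simps) (simp add: algebra_simps)
  then have "r - 2 * k + d + (k - d)\<^sup>2 / (r - 2 * m)
     = (r - k)\<^sup>2 / (r - d) + (k - d)\<^sup>2 * (2 * m - d) / ((r - 2 * m) * (r - d))"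
    using pos by (simp add: divide_simps) (simp add: algebra_simps power2_eq_square)
  also have "\<dots> \<le> (r - k)\<^sup>2 / (r - d) + (2 * m ^ 3 * (r - k)\<^sup>2 / (r - 2 * m)\<^sup>2) / ((r - 2 * m) * (r - d))"
  proof (intro add_left_mono divide_right_mono)
    have "(k - d)\<^sup>2 * (2 * m - d) \<le> m\<^sup>2 * (2 * m)"
      using k2 assms pos by (intro mult_mono) auto
    also have "\<dots> = 2 * m ^ 3 * 1" by (simp add: power2_eq_square power3_eq_cube)
    also have "\<dots> \<le> 2 * m ^ 3 * ((r - k)\<^sup>2 / (r - 2 * m)\<^sup>2)"
      using pos assms by (intro mult_left_mono) (auto simp: field_simps intro!: power_mono)
    finally show "(k - d)\<^sup>2 * (2 * m - d) \<le> 2 * m ^ 3 * (r - k)\<^sup>2 / (r - 2 * m)\<^sup>2" by simp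
    show "0 \<le> (r - 2 * m) * (r - d)" using pos by simp
  qed
  also have "(r - k)\<^sup>2 / (r - d) + (2 * m ^ 3 * (r - k)\<^sup>2 / (r - 2 * m)\<^sup>2) / ((r - 2 * m) * (r - d))
     = (r - k)\<^sup>2 / (r - d) * (1 + \<epsilon>)"
    unfolding \<epsilon>_def by (simp add: power3_eq_cube power2_eq_square algebra_simps)
  also have "\<dots> \<le> (r - k)\<^sup>2 / (r - d) * exp \<epsilon>"
    using pos by (intro mult_left_mono exp_ge_add_one_self) auto
  also have "\<dots> = (r - k)\<^sup>2 / r * (r / (r - d) * exp \<epsilon>)" using pos by simp
  also have "\<dots> \<le> (r - k)\<^sup>2 / r * (exp (d * ((1 / r + 1 / (r - (m - 1))) / 2)) * exp \<epsilon>)"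
  proof (intro mult_left_mono mult_right_mono)
    have "ln (r / (r - d)) \<le> d / 2 * (1 / r + 1 / (r - d))"
      using pos assms by (intro ln_quotient_le) auto
    also have "\<dots> \<le> d / 2 * (1 / r + 1 / (r - (m - 1)))"
      using pos assms by (intro mult_left_mono add_left_mono divide_left_mono) auto
    finally have "exp (ln (r / (r - d))) \<le> exp (d * ((1 / r + 1 / (r - (m - 1))) / 2))"
      by simp
    then show "r / (r - d) \<le> exp (d * ((1 / r + 1 / (r - (m - 1))) / 2))" using pos by simp
  qed (use pos in auto)
  finally show ?thesis unfolding \<epsilon>_def[symmetric] exp_add .
qed

locale two_stackings =
  fixes E :: "'e set" and m :: nat and a b :: "nat \<Rightarrow> 'e \<Rightarrow> 'e"
  assumes finE: "finite E"
    and bij_a: "\<And>i. i \<in> {1..m} \<Longrightarrow> bij_betw (a i) E E"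
    and bij_b: "\<And>i. i \<in> {1..m} \<Longrightarrow> bij_betw (b i) E E"
begin

text \<open>The vertex \<open>(i, x)\<close> is the edge \<open>x\<close> of the \<open>i\<close>-th copy of the complete graph, which the two
  stackings move to \<open>a i x\<close> and \<open>b i x\<close>.\<close>

definition adj :: "nat \<times> 'e \<Rightarrow> nat \<times> 'e \<Rightarrow> bool" where
  "adj u w \<longleftrightarrow> fst u \<noteq> fst w \<and>
     (a (fst u) (snd u) = a (fst w) (snd w) \<or> b (fst u) (snd u) = b (fst w) (snd w))"

definition fiber :: "(nat \<Rightarrow> 'e \<Rightarrow> 'e) \<Rightarrow> nat \<Rightarrow> 'e \<Rightarrow> (nat \<times> 'e) set" where
  "fiber c k y = {(j, x). j \<in> {1..k} \<and> x \<in> E \<and> c j x = y}"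

text \<open>When the vertex \<open>(Suc k, e)\<close> is added, its two cliques are these fibers,
  with one vertex per earlier layer each; this is the size \<open>d\<close> of their common
  part.\<close>

definition overlap :: "nat \<Rightarrow> 'e \<Rightarrow> nat" where
  "overlap k e = card (fiber a k (a (Suc k) e) \<inter> fiber b k (b (Suc k) e))"

lemma symp_adj: "symp adj" and irreflp_adj: "irreflp adj"
  by (auto simp: adj_def intro!: sympI irreflpI)

lemma fiber_eq_image:
  assumes "\<And>i. i \<in> {1..k} \<Longrightarrow> bij_betw (c i) E E" "y \<in> E"
  shows "fiber c k y = (\<lambda>j. (j, inv_into E (c j) y)) ` {1..k}"
proof (rule set_eqI, rule iffI)
  fix p assume "p \<in> fiber c k y"
  then have p: "fst p \<in> {1..k}" "snd p \<in> E" "c (fst p) (snd p) = y"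
    unfolding fiber_def by auto
  then have "snd p = inv_into E (c (fst p)) y"
    using bij_betw_inv_into_left[OF assms(1), of "fst p" "snd p"] by simp
  then show "p \<in> (\<lambda>j. (j, inv_into E (c j) y)) ` {1..k}"
    using p(1) by (intro image_eqI[of _ _ "fst p"] prod_eqI) simp_all
next
  fix p assume "p \<in> (\<lambda>j. (j, inv_into E (c j) y)) ` {1..k}"
  then obtain j where j: "j \<in> {1..k}" "p = (j, inv_into E (c j) y)" by blast
  then show "p \<in> fiber c k y"
    using bij_betw_inv_into_right[OF assms(1)[OF j(1)] assms(2)]
      bij_betw_apply[OF bij_betw_inv_into[OF assms(1)[OF j(1)]] assms(2)]
    unfolding fiber_def by simp
qed

lemma card_fiber:
  assumes "\<And>i. i \<in> {1..k} \<Longrightarrow> bij_betw (c i) E E" "y \<in> E"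
  shows "card (fiber c k y) = k" "finite (fiber c k y)"
  using fiber_eq_image[OF assms] by (auto simp: card_image inj_on_def)

lemma card_neighbors_le:
  assumes u: "u \<in> {1..m} \<times> E" and V: "V \<subseteq> {1..m} \<times> E"
  shows "card {x\<in>V. adj u x} \<le> 2 * m"
proof -
  have y: "a (fst u) (snd u) \<in> E" "b (fst u) (snd u) \<in> E"
    using u bij_a[of "fst u"] bij_b[of "fst u"] by (auto simp: mem_Times_iff dest: bij_betwE)
  let ?A = "fiber a m (a (fst u) (snd u))" and ?B = "fiber b m (b (fst u) (snd u))"
  have "{x\<in>V. adj u x} \<subseteq> ?A \<union> ?B" using V unfolding adj_def fiber_def by auto
  then have "card {x\<in>V. adj u x} \<le> card (?A \<union> ?B)"
    using card_fiber(2)[OF bij_a y(1)] card_fiber(2)[OF bij_b y(2)] by (intro card_mono) auto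
  also have "\<dots> \<le> card ?A + card ?B" by (rule card_Un_le)
  also have "\<dots> = 2 * m" using card_fiber(1)[OF bij_a y(1)] card_fiber(1)[OF bij_b y(2)] by simp
  finally show ?thesis .
qed

text \<open>Vertices are added layer by layer. No two vertices of one layer are adjacent, so the
  neighbors of a new vertex do not depend on \<open>X\<close>.\<close>

definition layers :: "nat \<Rightarrow> 'e set \<Rightarrow> (nat \<times> 'e) set" where
  "layers k X = {1..k} \<times> E \<union> {Suc k} \<times> X"

lemma layers_insert: "layers k (insert e X) = insert (Suc k, e) (layers k X)"
  and layers_empty: "layers k {} = {1..k} \<times> E"
  and layers_full: "layers k E = {1..Suc k} \<times> E"
  by (auto simp: layers_def)

lemma neighbors_new_vertex:
  "{w \<in> layers k X. adj (Suc k, e) w} = fiber a k (a (Suc k) e) \<union> fiber b k (b (Suc k) e)"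
  by (auto simp: layers_def adj_def fiber_def)

lemma overlap_le:
  assumes "Suc k \<le> m" "e \<in> E"
  shows "overlap k e \<le> k"
proof -
  have "a (Suc k) e \<in> E" using assms bij_a[of "Suc k"] by (auto dest: bij_betwE)
  then have "card (fiber a k (a (Suc k) e)) = k" "finite (fiber a k (a (Suc k) e))"
    using card_fiber[of k a] bij_a assms by auto
  then show ?thesis unfolding overlap_def by (metis card_mono inf_le1)
qed

lemma card_proper_colorings_layer_le:
  assumes C: "finite C" "card C = r" "2 * m < r" and k: "Suc k \<le> m" and X: "X \<subseteq> E"
  shows "real (card (proper_colorings adj (layers k X) C))
     \<le> real (card (proper_colorings adj ({1..k} \<times> E) C)) *
       (\<Prod>e\<in>X. (real r - 2 * real k + real (overlap k e)
          + (real k - real (overlap k e))\<^sup>2 / (real r - 2 * real m)))"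
    (is "_ \<le> _ * (\<Prod>e\<in>X. ?f e)")
  using finite_subset[OF X finE] X
proof (induction X rule: finite_induct)
  case empty
  then show ?case by (simp add: layers_empty)
next
  case (insert e X)
  let ?V = "layers k X"
  have V: "?V \<subseteq> {1..m} \<times> E" "finite ?V" "(Suc k, e) \<notin> ?V"
    using insert k finE by (auto simp: layers_def finite_subset)
  have y: "a (Suc k) e \<in> E" "b (Suc k) e \<in> E"
    using insert.prems bij_a[of "Suc k"] bij_b[of "Suc k"] k by (auto dest: bij_betwE)
  have "real (card (proper_colorings adj (insert (Suc k, e) ?V) C))
     \<le> real (card (proper_colorings adj ?V C)) *
       (real r - 2 * real k + real (overlap k e)
          + (real k - real (overlap k e))\<^sup>2 / (real r - real (2 * m)))"
  proof (rule card_proper_colorings_insert_two_cliques[OF symp_adj irreflp_adj V(2) C(1) V(3)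
        neighbors_new_vertex])
    show "card (fiber a k (a (Suc k) e)) = k" "card (fiber b k (b (Suc k) e)) = k"
      using k y by (auto intro!: card_fiber bij_a bij_b)
    show "card {x\<in>?V. adj u x} \<le> 2 * m" if "u \<in> ?V" for u
      using V(1) that by (intro card_neighbors_le) auto
    \<comment> \<open>Distinct vertices of a fiber lie in different layers, which \<open>adj\<close>
      demands.\<close>
    have inj: "x = x'" if "j \<in> {1..k}" "x \<in> E" "x' \<in> E" "a j x = a j x' \<or> b j x = b j x'" for j x x'
      using that bij_a[of j] bij_b[of j] k by (auto simp: bij_betw_def inj_on_def)
    show "adj u w" if "u \<in> fiber a k (a (Suc k) e)" "w \<in> fiber a k (a (Suc k) e)" "u \<noteq> w" for u w
      using that inj unfolding fiber_def adj_def by fastforce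
    show "adj u w" if "u \<in> fiber b k (b (Suc k) e)" "w \<in> fiber b k (b (Suc k) e)" "u \<noteq> w" for u w
      using that inj unfolding fiber_def adj_def by fastforce
  qed (use C in \<open>auto simp: overlap_def\<close>)
  then have "real (card (proper_colorings adj (layers k (insert e X)) C))
     \<le> real (card (proper_colorings adj ?V C)) * ?f e"
    unfolding layers_insert by simp
  also have "\<dots> \<le> (real (card (proper_colorings adj ({1..k} \<times> E) C)) * (\<Prod>e\<in>X. ?f e)) * ?f e"
  proof (rule mult_right_mono)
    show "0 \<le> ?f e" using C(3) k by (intro add_nonneg_nonneg) auto
  qed (use insert in auto)
  finally show ?case using insert.hyps by (simp add: mult_ac)
qed

lemma card_proper_colorings_le:
  assumes C: "finite C" "card C = r" "2 * m < r" and "k \<le> m"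
  shows "real (card (proper_colorings adj ({1..k} \<times> E) C))
     \<le> (\<Prod>l<k. \<Prod>e\<in>E. (real r - real l)\<^sup>2 / real r *
          exp (real (overlap l e) * ((1 / real r + 1 / (real r - (real m - 1))) / 2)
               + 2 * real m ^ 3 / (real r - 2 * real m) ^ 3))"
  using \<open>k \<le> m\<close>
proof (induction k)
  case 0
  have "proper_colorings adj ({1..0} \<times> E) C = {\<lambda>_. undefined}"
    unfolding proper_colorings_def by auto
  then show ?case by simp
next
  case (Suc k)
  let ?f = "\<lambda>e. real r - 2 * real k + real (overlap k e)
          + (real k - real (overlap k e))\<^sup>2 / (real r - 2 * real m)"
  have "real (card (proper_colorings adj ({1..Suc k} \<times> E) C))
      \<le> real (card (proper_colorings adj ({1..k} \<times> E) C)) * (\<Prod>e\<in>E. ?f e)"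
    using card_proper_colorings_layer_le[OF C Suc.prems subset_refl] unfolding layers_full .
  also have "\<dots> \<le> (\<Prod>l<k. \<Prod>e\<in>E. (real r - real l)\<^sup>2 / real r *
          exp (real (overlap l e) * ((1 / real r + 1 / (real r - (real m - 1))) / 2)
               + 2 * real m ^ 3 / (real r - 2 * real m) ^ 3)) *
      (\<Prod>e\<in>E. (real r - real k)\<^sup>2 / real r *
          exp (real (overlap k e) * ((1 / real r + 1 / (real r - (real m - 1))) / 2)
               + 2 * real m ^ 3 / (real r - 2 * real m) ^ 3))"
  proof (intro mult_mono prod_mono conjI prod_nonneg ballI)
    fix e assume e: "e \<in> E"
    show "?f e \<le> (real r - real k)\<^sup>2 / real r *
          exp (real (overlap k e) * ((1 / real r + 1 / (real r - (real m - 1))) / 2)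
               + 2 * real m ^ 3 / (real r - 2 * real m) ^ 3)"
      using overlap_le[OF Suc.prems e] C(3) Suc.prems
      by (intro two_clique_factor_le) auto
    show "0 \<le> ?f e" using C(3) Suc.prems by (intro add_nonneg_nonneg) auto
  next
    show "0 \<le> real r - 2 * real k + real (overlap k e)
        + (real k - real (overlap k e))\<^sup>2 / (real r - 2 * real m)" for e
      using C(3) Suc.prems by (intro add_nonneg_nonneg) auto
  qed (use Suc in \<open>auto intro!: prod_nonneg\<close>)
  finally show ?case by simp
qed

text \<open>For \<open>b = a\<close> the graph belongs to a single stacking: the earlier neighbors
  of a vertex form one clique of size \<open>l\<close> and block exactly \<open>l\<close> colors in
  every proper coloring, so the count is exact. For \<open>r < k\<close> the factor with
  \<open>l = r\<close> is zero.\<close>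

lemma card_proper_colorings_eq:
  assumes C: "finite C" "card C = r" and "k \<le> m" and ba: "b = a"
  shows "card (proper_colorings adj ({1..k} \<times> E) C) = (\<Prod>l<k. r - l) ^ card E"
  using \<open>k \<le> m\<close>
proof (induction k)
  case 0
  have "proper_colorings adj ({1..0} \<times> E) C = {\<lambda>_. undefined}"
    unfolding proper_colorings_def by auto
  then show ?case by simp
next
  case (Suc k)
  have "card (proper_colorings adj (layers k X) C)
      = card (proper_colorings adj ({1..k} \<times> E) C) * (r - k) ^ card X" if X: "X \<subseteq> E" for X
    using finite_subset[OF X finE] X
  proof (induction X rule: finite_induct)
    case empty
    then show ?case by (simp add: layers_empty)
  next
    case (insert e X)
    let ?V = "layers k X" and ?F = "fiber a k (a (Suc k) e)"
    have V: "finite ?V" "(Suc k, e) \<notin> ?V"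
      using insert finE by (auto simp: layers_def)
    have F: "card ?F = k" "finite ?F"
      using Suc.prems insert.prems bij_a[of "Suc k"]
      by (auto intro!: card_fiber bij_a dest: bij_betwE)
    have inj: "x = x'" if "j \<in> {1..k}" "x \<in> E" "x' \<in> E" "a j x = a j x'" for j x x'
      using that bij_a[of j] Suc.prems by (auto simp: bij_betw_def inj_on_def)
    have cl: "adj u w" if "u \<in> ?F" "w \<in> ?F" "u \<noteq> w" for u w
      using that inj unfolding fiber_def adj_def by fastforce
    have nb: "{w \<in> ?V. adj (Suc k, e) w} = ?F"
      using neighbors_new_vertex[of k X e] ba by simp
    have "card (C - \<kappa> ` ?F) = r - k" if \<kappa>: "\<kappa> \<in> proper_colorings adj ?V C" for \<kappa>
    proof -
      have FV: "?F \<subseteq> ?V" using nb by auto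
      have "inj_on \<kappa> ?F"
        using proper_coloringsD(2)[OF \<kappa>] cl FV unfolding inj_on_def by (meson subsetD)
      moreover have "\<kappa> ` ?F \<subseteq> C" using proper_coloringsD(1)[OF \<kappa>] FV by (auto simp: PiE_def Pi_def)
      ultimately show ?thesis using F C by (subst card_Diff_subset) (auto simp: card_image)
    qed
    then have "card (proper_colorings adj (insert (Suc k, e) ?V) C)
        = card (proper_colorings adj ?V C) * (r - k)"
      using card_proper_colorings_insert[OF symp_adj irreflpD[OF irreflp_adj] V(1) C(1) V(2)]
      unfolding nb by simp
    then show ?case using insert by (simp add: layers_insert)
  qed
  from this[OF subset_refl] show ?case
    using Suc by (simp add: layers_full power_mult_distrib)
qed

end

section \<open>Sums over tuples and second moments\<close>

text \<open>Once the center value \<open>\<rho> i\<close> is fixed, the leaves are summed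
  independently, and each leaf sum is \<open>Q\<close> whatever the center value is.\<close>

lemma sum_PiE_star:
  fixes g :: "'a \<Rightarrow> 'a \<Rightarrow> 'b :: {comm_semiring_1}"
  assumes I: "finite I" "i \<in> I" and P: "finite P" and g: "\<And>p. p \<in> P \<Longrightarrow> (\<Sum>q\<in>P. g p q) = Q"
  shows "(\<Sum>\<rho>\<in>I \<rightarrow>\<^sub>E P. \<Prod>j\<in>I - {i}. g (\<rho> i) (\<rho> j)) = of_nat (card P) * Q ^ (card I - 1)"
proof -
  \<comment> \<open>An indicator of the center value turns the summand into a product with one
    factor per coordinate, the shape required by \<open>prod_sum_PiE\<close>.\<close>
  have "(\<Sum>\<rho>\<in>I \<rightarrow>\<^sub>E P. \<Prod>j\<in>I - {i}. g (\<rho> i) (\<rho> j))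
      = (\<Sum>\<rho>\<in>I \<rightarrow>\<^sub>E P. \<Sum>p\<in>P. of_bool (\<rho> i = p) * (\<Prod>j\<in>I - {i}. g p (\<rho> j)))"
  proof (rule sum.cong[OF refl])
    fix \<rho> assume "\<rho> \<in> I \<rightarrow>\<^sub>E P"
    then have "\<rho> i \<in> P" using I by auto
    then have "(\<Sum>p\<in>P. if p = \<rho> i then \<Prod>j\<in>I - {i}. g p (\<rho> j) else 0)
        = (\<Prod>j\<in>I - {i}. g (\<rho> i) (\<rho> j))"
      using P by (simp add: sum.delta')
    then show "(\<Prod>j\<in>I - {i}. g (\<rho> i) (\<rho> j))
        = (\<Sum>p\<in>P. of_bool (\<rho> i = p) * (\<Prod>j\<in>I - {i}. g p (\<rho> j)))"
      by (simp add: of_bool_def if_distrib[of "\<lambda>x. x * _"] eq_commute cong: if_cong)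
  qed
  also have "\<dots> = (\<Sum>p\<in>P. \<Sum>\<rho>\<in>I \<rightarrow>\<^sub>E P. \<Prod>j\<in>I. if j = i then of_bool (\<rho> j = p) else g p (\<rho> j))"
    using I by (subst sum.swap) (simp add: prod.remove[of I i])
  also have "\<dots> = (\<Sum>p\<in>P. \<Prod>j\<in>I. \<Sum>q\<in>P. if j = i then of_bool (q = p) else g p q)"
    using I P by (subst prod_sum_PiE) auto
  also have "\<dots> = (\<Sum>p\<in>P. Q ^ (card I - 1))"
  proof (rule sum.cong[OF refl])
    fix p assume p: "p \<in> P"
    have "(\<Prod>j\<in>I. \<Sum>q\<in>P. if j = i then of_bool (q = p) else g p q)
        = (\<Sum>q\<in>P. of_bool (q = p)) * (\<Prod>j\<in>I - {i}. \<Sum>q\<in>P. g p q)"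
      using I by (simp add: prod.remove[of I i])
    also have "(\<Sum>q\<in>P. of_bool (q = p)) = (1 :: 'b)"
      using P p by (simp add: of_bool_def sum.delta')
    finally show "(\<Prod>j\<in>I. \<Sum>q\<in>P. if j = i then of_bool (q = p) else g p q) = Q ^ (card I - 1)"
      using g[OF p] I by simp
  qed
  finally show ?thesis by simp
qed

text \<open>The complete graph on \<open>I\<close> is the average of its spanning stars with all weights scaled by
  \<open>card I / 2\<close>, and for a star the sum factorizes.\<close>

lemma sum_PiE_exp_pairs_le:
  fixes f :: "'a \<Rightarrow> 'a \<Rightarrow> real"
  assumes I: "finite I" "I \<noteq> {}" and P: "finite P"
    and Q: "\<And>p. p \<in> P \<Longrightarrow> (\<Sum>q\<in>P. exp (y * real (card I) / 2 * f p q)) = Q"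
  shows "(\<Sum>\<rho>\<in>I \<rightarrow>\<^sub>E P. exp (y / 2 * (\<Sum>i\<in>I. \<Sum>j\<in>I - {i}. f (\<rho> i) (\<rho> j))))
         \<le> real (card P) * Q ^ (card I - 1)"
proof -
  let ?h = "\<lambda>\<rho> i. exp (y * real (card I) / 2 * (\<Sum>j\<in>I - {i}. f (\<rho> i) (\<rho> j)))"
  have c: "real (card I) > 0" using I by (simp add: card_gt_0_iff)
  have "exp (y / 2 * (\<Sum>i\<in>I. \<Sum>j\<in>I - {i}. f (\<rho> i) (\<rho> j))) \<le> (\<Sum>i\<in>I. 1 / real (card I) * ?h \<rho> i)" for \<rho>
  proof -
    have "exp (\<Sum>i\<in>I. (1 / real (card I)) *\<^sub>R (y * real (card I) / 2 * (\<Sum>j\<in>I - {i}. f (\<rho> i) (\<rho> j))))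
        \<le> (\<Sum>i\<in>I. 1 / real (card I) * ?h \<rho> i)"
      using I c by (intro convex_on_sum[OF _ _ exp_convex]) auto
    also have "(\<Sum>i\<in>I. (1 / real (card I)) *\<^sub>R (y * real (card I) / 2 * (\<Sum>j\<in>I - {i}. f (\<rho> i) (\<rho> j))))
        = y / 2 * (\<Sum>i\<in>I. \<Sum>j\<in>I - {i}. f (\<rho> i) (\<rho> j))"
      using c by (simp add: sum_distrib_left)
    finally show ?thesis .
  qed
  then have "(\<Sum>\<rho>\<in>I \<rightarrow>\<^sub>E P. exp (y / 2 * (\<Sum>i\<in>I. \<Sum>j\<in>I - {i}. f (\<rho> i) (\<rho> j))))
      \<le> (\<Sum>\<rho>\<in>I \<rightarrow>\<^sub>E P. \<Sum>i\<in>I. 1 / real (card I) * ?h \<rho> i)"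
    by (rule sum_mono)
  also have "\<dots> = 1 / real (card I) * (\<Sum>i\<in>I. \<Sum>\<rho>\<in>I \<rightarrow>\<^sub>E P. ?h \<rho> i)"
    by (subst sum.swap) (simp add: sum_distrib_left)
  also have "(\<Sum>i\<in>I. \<Sum>\<rho>\<in>I \<rightarrow>\<^sub>E P. ?h \<rho> i) = (\<Sum>i\<in>I. real (card P) * Q ^ (card I - 1))"
  proof (rule sum.cong[OF refl])
    fix i assume i: "i \<in> I"
    have "(\<Sum>\<rho>\<in>I \<rightarrow>\<^sub>E P. ?h \<rho> i)
        = (\<Sum>\<rho>\<in>I \<rightarrow>\<^sub>E P. \<Prod>j\<in>I - {i}. exp (y * real (card I) / 2 * f (\<rho> i) (\<rho> j)))"
      using I by (simp add: sum_distrib_left exp_sum)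
    also have "\<dots> = real (card P) * Q ^ (card I - 1)"
      using I(1) i P Q by (rule sum_PiE_star)
    finally show "(\<Sum>\<rho>\<in>I \<rightarrow>\<^sub>E P. ?h \<rho> i) = real (card P) * Q ^ (card I - 1)" .
  qed
  finally show ?thesis using c by simp
qed

text \<open>Chebyshev's inequality in counting form: every \<open>w\<close> that is good for no
  \<open>s\<close> contributes \<open>\<mu>\<^sup>2\<close> to the sum of
  \<open>(X w - \<mu>)\<^sup>2\<close>.\<close>

lemma second_moment_count:
  fixes R :: "'s \<Rightarrow> 'w \<Rightarrow> bool" and p \<epsilon> :: real
  assumes fin: "finite S" "finite \<Omega>" and ne: "S \<noteq> {}" and p: "p > 0"
    and first: "\<And>s. s \<in> S \<Longrightarrow> real (card {w\<in>\<Omega>. R s w}) = p * real (card \<Omega>)"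
    and second: "(\<Sum>s\<in>S. \<Sum>t\<in>S. real (card {w\<in>\<Omega>. R s w \<and> R t w}))
        \<le> (1 + \<epsilon>) * (p * real (card S))\<^sup>2 * real (card \<Omega>)"
  shows "real (card {w\<in>\<Omega>. \<forall>s\<in>S. \<not> R s w}) \<le> \<epsilon> * real (card \<Omega>)"
proof -
  define X where "X w = (\<Sum>s\<in>S. of_bool (R s w) :: real)" for w
  define \<mu> where "\<mu> = p * real (card S)"
  have \<mu>: "\<mu> > 0" using fin ne p by (simp add: \<mu>_def card_gt_0_iff)
  have cnt: "real (card {w\<in>\<Omega>. A w}) = (\<Sum>w\<in>\<Omega>. of_bool (A w))" for A
    using fin by (simp add: Int_def)
  have EX: "(\<Sum>w\<in>\<Omega>. X w) = \<mu> * real (card \<Omega>)"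
    unfolding X_def \<mu>_def using first by (subst sum.swap) (simp only: cnt[symmetric], simp)
  have "(\<Sum>w\<in>\<Omega>. (X w)\<^sup>2) = (\<Sum>w\<in>\<Omega>. \<Sum>s\<in>S. \<Sum>t\<in>S. of_bool (R s w \<and> R t w))"
    unfolding X_def by (simp add: power2_eq_square sum_product of_bool_conj)
  also have "\<dots> = (\<Sum>s\<in>S. \<Sum>w\<in>\<Omega>. \<Sum>t\<in>S. of_bool (R s w \<and> R t w))" by (rule sum.swap)
  also have "\<dots> = (\<Sum>s\<in>S. \<Sum>t\<in>S. \<Sum>w\<in>\<Omega>. of_bool (R s w \<and> R t w))"
    by (intro sum.cong refl sum.swap)
  also have "\<dots> = (\<Sum>s\<in>S. \<Sum>t\<in>S. real (card {w\<in>\<Omega>. R s w \<and> R t w}))"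
    by (simp only: cnt)
  finally have EX2: "(\<Sum>w\<in>\<Omega>. (X w)\<^sup>2) \<le> (1 + \<epsilon>) * \<mu>\<^sup>2 * real (card \<Omega>)"
    using second unfolding \<mu>_def by simp
  have "\<mu>\<^sup>2 * real (card {w\<in>\<Omega>. \<forall>s\<in>S. \<not> R s w}) = (\<Sum>w\<in>{w\<in>\<Omega>. \<forall>s\<in>S. \<not> R s w}. (X w - \<mu>)\<^sup>2)"
  proof -
    have "X w = 0" if "w \<in> {w\<in>\<Omega>. \<forall>s\<in>S. \<not> R s w}" for w
      using that unfolding X_def by simp
    then show ?thesis by simp
  qed
  also have "\<dots> \<le> (\<Sum>w\<in>\<Omega>. (X w - \<mu>)\<^sup>2)" using fin by (intro sum_mono2) auto
  also have "\<dots> = (\<Sum>w\<in>\<Omega>. (X w)\<^sup>2) - 2 * \<mu> * (\<Sum>w\<in>\<Omega>. X w) + \<mu>\<^sup>2 * real (card \<Omega>)"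
    by (simp add: power2_diff sum.distrib sum_subtractf sum_distrib_left[symmetric] sum_distrib_right[symmetric])
  also have "\<dots> \<le> \<mu>\<^sup>2 * (\<epsilon> * real (card \<Omega>))"
    using EX2 unfolding EX by (simp add: algebra_simps power2_eq_square)
  finally show ?thesis using \<mu> by simp
qed

section \<open>Rainbow stackings as proper colorings\<close>

definition stackings :: "nat \<Rightarrow> nat \<Rightarrow> (nat \<Rightarrow> nat \<Rightarrow> nat) set" where
  "stackings m n = {1..m} \<rightarrow>\<^sub>E {p. p permutes {1..n}}"

definition coloring_tuples :: "nat \<Rightarrow> nat \<Rightarrow> 'c set \<Rightarrow> (nat \<Rightarrow> nat set \<Rightarrow> 'c) set" where
  "coloring_tuples m n C = {1..m} \<rightarrow>\<^sub>E edge_colorings n C"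

definition fixed_edges :: "nat \<Rightarrow> (nat \<Rightarrow> nat) \<Rightarrow> nat set set" where
  "fixed_edges n p = {e \<in> K_edges n. p ` e = e}"

lemma finite_K_edges: "finite (K_edges n)" and card_K_edges: "card (K_edges n) = n choose 2"
proof -
  have "K_edges n = {e. e \<subseteq> {1..n} \<and> card e = 2}"
    unfolding K_edges_def nsets_def by (auto intro: finite_subset)
  then show "finite (K_edges n)" "card (K_edges n) = n choose 2"
    using n_subsets[of "{1..n}" 2] by auto
qed

lemma stackings_permutes: "\<sigma> \<in> stackings m n \<Longrightarrow> i \<in> {1..m} \<Longrightarrow> \<sigma> i permutes {1..n}"
  unfolding stackings_def by auto

lemma finite_stackings: "finite (stackings m n)" and card_stackings: "card (stackings m n) = fact n ^ m"
  unfolding stackings_def using card_permutations[of "{1..n}" n]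
  by (auto simp: card_PiE finite_permutations intro!: finite_PiE)

lemma finite_coloring_tuples: "finite C \<Longrightarrow> finite (coloring_tuples m n C)"
  and card_coloring_tuples: "card (coloring_tuples m n C) = (card C ^ (n choose 2)) ^ m"
  unfolding coloring_tuples_def edge_colorings_def using finite_K_edges[of n]
  by (auto simp: card_PiE card_K_edges intro!: finite_PiE)

lemma image_inv_permutes:
  assumes "p permutes A"
  shows "p ` inv p ` e = e" "inv p ` p ` e = e"
  using permutes_inverses[OF assms] by (simp_all add: image_image)

lemma image_in_K_edges:
  assumes "p permutes {1..n}" "e \<in> K_edges n"
  shows "p ` e \<in> K_edges n"
proof -
  have "p ` e \<subseteq> {1..n}" using assms permutes_image[OF assms(1)] by (auto simp: K_edges_def nsets_def)
  moreover have "card (p ` e) = card e"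
    using permutes_inj_on[OF assms(1)] by (rule card_image)
  ultimately show ?thesis using assms(2) by (auto simp: K_edges_def nsets_def)
qed

lemma bij_betw_image_K_edges:
  assumes "p permutes {1..n}"
  shows "bij_betw ((`) p) (K_edges n) (K_edges n)"
  using assms image_in_K_edges[OF assms] image_in_K_edges[OF permutes_inv[OF assms]]
  by (intro bij_betw_byWitness[where f' = "(`) (inv p)"]) (auto simp: image_inv_permutes)

text \<open>Comparing images of edges instead of pulling one edge back puts the condition into the
  form of \<open>adj\<close>.\<close>

lemma rainbow_stacking_iff:
  assumes "\<sigma> \<in> stackings m n"
  shows "rainbow_stacking m n \<kappa> \<sigma> \<longleftrightarrow>
    (\<forall>i\<in>{1..m}. \<forall>j\<in>{1..m}. \<forall>x\<in>K_edges n. \<forall>y\<in>K_edges n.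
       i \<noteq> j \<and> \<sigma> i ` x = \<sigma> j ` y \<longrightarrow> \<kappa> i x \<noteq> \<kappa> j y)" (is "?L \<longleftrightarrow> ?R")
proof
  assume L: ?L
  show ?R
  proof (intro ballI impI)
    fix i j x y assume ij: "i \<in> {1..m}" "j \<in> {1..m}" and xy: "x \<in> K_edges n" "y \<in> K_edges n"
      and eq: "i \<noteq> j \<and> \<sigma> i ` x = \<sigma> j ` y"
    note p = stackings_permutes[OF assms]
    have "\<sigma> i ` x \<in> K_edges n" using p ij xy by (intro image_in_K_edges)
    then have "inj_on (\<lambda>k. \<kappa> k (inv (\<sigma> k) ` \<sigma> i ` x)) {1..m}"
      using L unfolding rainbow_stacking_def by blast
    then have "\<kappa> i (inv (\<sigma> i) ` \<sigma> i ` x) \<noteq> \<kappa> j (inv (\<sigma> j) ` \<sigma> i ` x)"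
      using ij eq unfolding inj_on_def by blast
    moreover have "inv (\<sigma> j) ` \<sigma> i ` x = y"
      using eq image_inv_permutes(2)[OF p[OF ij(2)], of y] by simp
    ultimately show "\<kappa> i x \<noteq> \<kappa> j y"
      by (simp only: image_inv_permutes(2)[OF p[OF ij(1)]]) simp
  qed
next
  assume R: ?R
  show ?L
    unfolding rainbow_stacking_def
  proof (intro conjI ballI)
    show "\<sigma> \<in> {1..m} \<rightarrow>\<^sub>E {p. p permutes {1..n}}" using assms unfolding stackings_def .
    fix e assume e: "e \<in> K_edges n"
    note p = stackings_permutes[OF assms]
    show "inj_on (\<lambda>i. \<kappa> i (inv (\<sigma> i) ` e)) {1..m}"
    proof (rule inj_onI, rule ccontr)
      fix i j assume ij: "i \<in> {1..m}" "j \<in> {1..m}" "\<kappa> i (inv (\<sigma> i) ` e) = \<kappa> j (inv (\<sigma> j) ` e)" "i \<noteq> j"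
      have "inv (\<sigma> i) ` e \<in> K_edges n" "inv (\<sigma> j) ` e \<in> K_edges n"
        using p ij e by (auto intro!: image_in_K_edges permutes_inv)
      moreover have "\<sigma> i ` inv (\<sigma> i) ` e = \<sigma> j ` inv (\<sigma> j) ` e"
        by (simp only: image_inv_permutes(1)[OF p[OF ij(1)]] image_inv_permutes(1)[OF p[OF ij(2)]])
      ultimately show False using R ij by blast
    qed
  qed
qed

lemma two_stackings_image:
  assumes "\<sigma> \<in> stackings m n" "\<sigma>' \<in> stackings m n"
  shows "two_stackings (K_edges n) m (\<lambda>i. (`) (\<sigma> i)) (\<lambda>i. (`) (\<sigma>' i))"
  using stackings_permutes[OF assms(1)] stackings_permutes[OF assms(2)]
  by unfold_locales (auto intro!: bij_betw_image_K_edges finite_K_edges)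

text \<open>The graph \<open>adj\<close> is the union of the conflict graphs of the two stackings,
  so uncurrying a tuple that is rainbow for both gives a proper coloring. The restrictions in both
  directions keep the functions extensional.\<close>

lemma card_rainbow_pair_eq:
  assumes \<sigma>: "\<sigma> \<in> stackings m n" "\<sigma>' \<in> stackings m n"
  shows "card {\<kappa> \<in> coloring_tuples m n C. rainbow_stacking m n \<kappa> \<sigma> \<and> rainbow_stacking m n \<kappa> \<sigma>'}
    = card (proper_colorings (two_stackings.adj (\<lambda>i. (`) (\<sigma> i)) (\<lambda>i. (`) (\<sigma>' i)))
              ({1..m} \<times> K_edges n) C)"
proof -
  interpret two_stackings "K_edges n" m "\<lambda>i. (`) (\<sigma> i)" "\<lambda>i. (`) (\<sigma>' i)"
    using \<sigma> by (rule two_stackings_image)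
  let ?V = "{1..m} \<times> K_edges n"
  have iff: "rainbow_stacking m n \<kappa> \<sigma> \<and> rainbow_stacking m n \<kappa> \<sigma>' \<longleftrightarrow>
      (\<forall>u\<in>?V. \<forall>w\<in>?V. adj u w \<longrightarrow> \<kappa> (fst u) (snd u) \<noteq> \<kappa> (fst w) (snd w))" for \<kappa> :: "nat \<Rightarrow> nat set \<Rightarrow> 'a"
    unfolding rainbow_stacking_iff[OF \<sigma>(1)] rainbow_stacking_iff[OF \<sigma>(2)] adj_def by auto
  have "bij_betw (\<lambda>\<kappa>. \<lambda>u\<in>?V. \<kappa> (fst u) (snd u))
      {\<kappa> \<in> coloring_tuples m n C. rainbow_stacking m n \<kappa> \<sigma> \<and> rainbow_stacking m n \<kappa> \<sigma>'}
      (proper_colorings adj ?V C)"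
  proof (rule bij_betw_byWitness[where f' = "\<lambda>f. \<lambda>i\<in>{1..m}. \<lambda>e\<in>K_edges n. f (i, e)"])
    show "\<forall>\<kappa>\<in>{\<kappa> \<in> coloring_tuples m n C. rainbow_stacking m n \<kappa> \<sigma> \<and> rainbow_stacking m n \<kappa> \<sigma>'}.
        (\<lambda>i\<in>{1..m}. \<lambda>e\<in>K_edges n. (\<lambda>u\<in>?V. \<kappa> (fst u) (snd u)) (i, e)) = \<kappa>"
    proof
      fix \<kappa> assume "\<kappa> \<in> {\<kappa> \<in> coloring_tuples m n C. rainbow_stacking m n \<kappa> \<sigma> \<and> rainbow_stacking m n \<kappa> \<sigma>'}"
      then have k: "\<kappa> \<in> {1..m} \<rightarrow>\<^sub>E (K_edges n \<rightarrow>\<^sub>E C)"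
        unfolding coloring_tuples_def edge_colorings_def by simp
      show "(\<lambda>i\<in>{1..m}. \<lambda>e\<in>K_edges n. (\<lambda>u\<in>?V. \<kappa> (fst u) (snd u)) (i, e)) = \<kappa>"
      proof (intro ext)
        fix i e
        show "(\<lambda>i\<in>{1..m}. \<lambda>e\<in>K_edges n. (\<lambda>u\<in>?V. \<kappa> (fst u) (snd u)) (i, e)) i e = \<kappa> i e"
        proof (cases "i \<in> {1..m}")
          case True
          then have "\<kappa> i \<in> K_edges n \<rightarrow>\<^sub>E C" using k by auto
          then have "\<kappa> i e = undefined" if "e \<notin> K_edges n" using that by (rule PiE_arb)
          then show ?thesis using True by auto
        next
          case False
          then show ?thesis using PiE_arb[OF k False] by (simp only: restrict_apply if_False)
        qed
      qed
    qed
    show "\<forall>f\<in>proper_colorings adj ?V C.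
        (\<lambda>u\<in>?V. (\<lambda>i\<in>{1..m}. \<lambda>e\<in>K_edges n. f (i, e)) (fst u) (snd u)) = f"
    proof
      fix f assume "f \<in> proper_colorings adj ?V C"
      note f = proper_coloringsD(1)[OF this]
      show "(\<lambda>u\<in>?V. (\<lambda>i\<in>{1..m}. \<lambda>e\<in>K_edges n. f (i, e)) (fst u) (snd u)) = f"
      proof (rule ext)
        fix u show "(\<lambda>u\<in>?V. (\<lambda>i\<in>{1..m}. \<lambda>e\<in>K_edges n. f (i, e)) (fst u) (snd u)) u = f u"
          using PiE_arb[OF f, of u] by (cases "u \<in> ?V") (auto simp: restrict_def)
      qed
    qed
    show "(\<lambda>\<kappa>. \<lambda>u\<in>?V. \<kappa> (fst u) (snd u)) `
        {\<kappa> \<in> coloring_tuples m n C. rainbow_stacking m n \<kappa> \<sigma> \<and> rainbow_stacking m n \<kappa> \<sigma>'}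
        \<subseteq> proper_colorings adj ?V C"
    proof safe
      fix \<kappa> assume k: "\<kappa> \<in> coloring_tuples m n C"
        and "rainbow_stacking m n \<kappa> \<sigma>" "rainbow_stacking m n \<kappa> \<sigma>'"
      then have "\<forall>u\<in>?V. \<forall>w\<in>?V. adj u w \<longrightarrow> \<kappa> (fst u) (snd u) \<noteq> \<kappa> (fst w) (snd w)"
        using iff by blast
      moreover have "(\<lambda>u\<in>?V. \<kappa> (fst u) (snd u)) \<in> ?V \<rightarrow>\<^sub>E C"
        using k unfolding coloring_tuples_def edge_colorings_def by (auto simp: PiE_def Pi_def)
      ultimately show "(\<lambda>u\<in>?V. \<kappa> (fst u) (snd u)) \<in> proper_colorings adj ?V C"
        unfolding proper_colorings_def by auto
    qed
    show "(\<lambda>f. \<lambda>i\<in>{1..m}. \<lambda>e\<in>K_edges n. f (i, e)) ` proper_colorings adj ?V C \<subseteq>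
        {\<kappa> \<in> coloring_tuples m n C. rainbow_stacking m n \<kappa> \<sigma> \<and> rainbow_stacking m n \<kappa> \<sigma>'}"
    proof (rule image_subsetI)
      fix f assume "f \<in> proper_colorings adj ?V C"
      note f = proper_coloringsD[OF this]
      let ?\<kappa> = "\<lambda>i\<in>{1..m}. \<lambda>e\<in>K_edges n. f (i, e)"
      have "?\<kappa> \<in> coloring_tuples m n C"
        using f(1) unfolding coloring_tuples_def edge_colorings_def by (auto simp: PiE_def Pi_def)
      moreover have "rainbow_stacking m n ?\<kappa> \<sigma> \<and> rainbow_stacking m n ?\<kappa> \<sigma>'"
        unfolding iff using f(2) by auto
      ultimately show "?\<kappa> \<in> {\<kappa> \<in> coloring_tuples m n C. rainbow_stacking m n \<kappa> \<sigma> \<and> rainbow_stacking m n \<kappa> \<sigma>'}"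
        by blast
    qed
  qed
  then show ?thesis by (rule bij_betw_same_card)
qed

text \<open>This is the pair count of \<open>\<sigma>\<close> with itself, where the two cliques
  coincide.\<close>

lemma card_rainbow_eq:
  assumes "\<sigma> \<in> stackings m n" "finite C"
  shows "card {\<kappa> \<in> coloring_tuples m n C. rainbow_stacking m n \<kappa> \<sigma>}
    = (\<Prod>l<m. card C - l) ^ (n choose 2)"
  using card_rainbow_pair_eq[OF assms(1,1), of C]
  unfolding two_stackings.card_proper_colorings_eq[OF two_stackings_image[OF assms(1,1)] assms(2) refl le_refl refl]
    card_K_edges conj_absorb .

text \<open>An edge of layer \<open>j\<close> and the edge \<open>e\<close> of layer
  \<open>Suc k\<close> meet in both stackings exactly if the relative permutations
  \<open>\<sigma>' j \<circ> inv (\<sigma> j)\<close> and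
  \<open>\<sigma>' (Suc k) \<circ> inv (\<sigma> (Suc k))\<close> agree at the image of
  \<open>e\<close> under \<open>\<sigma> (Suc k)\<close>. Summed over a layer, the overlaps
  therefore count the edges on which relative permutations agree.\<close>

lemma card_rainbow_pair_le:
  assumes \<sigma>: "\<sigma> \<in> stackings m n" "\<sigma>' \<in> stackings m n" and C: "finite C" "card C = r" "2 * m < r"
  shows "real (card {\<kappa> \<in> coloring_tuples m n C. rainbow_stacking m n \<kappa> \<sigma> \<and> rainbow_stacking m n \<kappa> \<sigma>'})
    \<le> (\<Prod>l<m. (real r - real l)\<^sup>2 / real r) ^ (n choose 2)
       * exp (real (m * (n choose 2)) * (2 * real m ^ 3 / (real r - 2 * real m) ^ 3))
       * exp ((1 / real r + 1 / (real r - (real m - 1))) / 2 / 2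
           * (\<Sum>i\<in>{1..m}. \<Sum>j\<in>{1..m} - {i}.
               real (card {e \<in> K_edges n. (\<sigma>' i \<circ> inv (\<sigma> i)) ` e = (\<sigma>' j \<circ> inv (\<sigma> j)) ` e})))"
proof -
  let ?E = "K_edges n"
  interpret two_stackings ?E m "\<lambda>i. (`) (\<sigma> i)" "\<lambda>i. (`) (\<sigma>' i)"
    using \<sigma> by (rule two_stackings_image)
  note p = stackings_permutes[OF \<sigma>(1)]
  define y where "y = (1 / real r + 1 / (real r - (real m - 1))) / 2"
  define \<epsilon> where "\<epsilon> = 2 * real m ^ 3 / (real r - 2 * real m) ^ 3"
  define F where "F i j = real (card {e \<in> ?E. (\<sigma>' i \<circ> inv (\<sigma> i)) ` e = (\<sigma>' j \<circ> inv (\<sigma> j)) ` e})" for i j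
  have F_sym: "F i j = F j i" for i j unfolding F_def by (simp add: eq_commute)
  have overlap: "overlap k e = card {j \<in> {1..k}. (\<sigma>' j \<circ> inv (\<sigma> j)) ` (\<sigma> (Suc k) ` e)
        = (\<sigma>' (Suc k) \<circ> inv (\<sigma> (Suc k))) ` (\<sigma> (Suc k) ` e)}" if k: "k < m" and e: "e \<in> ?E" for k e
  proof -
    have "bij_betw fst (fiber (\<lambda>i. (`) (\<sigma> i)) k (\<sigma> (Suc k) ` e) \<inter> fiber (\<lambda>i. (`) (\<sigma>' i)) k (\<sigma>' (Suc k) ` e))
       {j \<in> {1..k}. (\<sigma>' j \<circ> inv (\<sigma> j)) ` (\<sigma> (Suc k) ` e)
        = (\<sigma>' (Suc k) \<circ> inv (\<sigma> (Suc k))) ` (\<sigma> (Suc k) ` e)}" (is "bij_betw fst ?A ?B")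
    \<comment> \<open>The witness pairs \<open>j\<close> with the only edge of layer
      \<open>j\<close> that the first stacking moves to the place of \<open>e\<close>.\<close>
    proof (rule bij_betw_byWitness[where f' = "\<lambda>j. (j, inv (\<sigma> j) ` \<sigma> (Suc k) ` e)"])
      have A: "fst u \<in> {1..k}" "snd u \<in> ?E" "\<sigma> (fst u) ` snd u = \<sigma> (Suc k) ` e"
        "\<sigma>' (fst u) ` snd u = \<sigma>' (Suc k) ` e" "inv (\<sigma> (fst u)) ` \<sigma> (Suc k) ` e = snd u"
        if "u \<in> ?A" for u
      proof -
        show u: "fst u \<in> {1..k}" "snd u \<in> ?E" "\<sigma> (fst u) ` snd u = \<sigma> (Suc k) ` e"
          "\<sigma>' (fst u) ` snd u = \<sigma>' (Suc k) ` e"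
          using that unfolding fiber_def by auto
        show "inv (\<sigma> (fst u)) ` \<sigma> (Suc k) ` e = snd u"
          unfolding u(3)[symmetric] using u(1) k by (intro image_inv_permutes(2)[OF p]) auto
      qed
      have S: "inv (\<sigma> (Suc k)) ` \<sigma> (Suc k) ` e = e"
        using k by (intro image_inv_permutes(2)[OF p]) auto
      show "\<forall>u\<in>?A. (fst u, inv (\<sigma> (fst u)) ` \<sigma> (Suc k) ` e) = u"
        using A(5) by (intro ballI prod_eqI) (simp_all only: fst_conv snd_conv)
      show "\<forall>j\<in>?B. fst (j, inv (\<sigma> j) ` \<sigma> (Suc k) ` e) = j" by simp
      show "fst ` ?A \<subseteq> ?B"
      proof (rule image_subsetI)
        fix u assume u: "u \<in> ?A"
        have "\<sigma>' (fst u) ` inv (\<sigma> (fst u)) ` \<sigma> (Suc k) ` e = \<sigma>' (Suc k) ` inv (\<sigma> (Suc k)) ` \<sigma> (Suc k) ` e"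
          by (simp only: A(4,5)[OF u] S)
        then show "fst u \<in> ?B" using A(1)[OF u] by (simp only: image_comp mem_Collect_eq simp_thms o_assoc)
      qed
      show "(\<lambda>j. (j, inv (\<sigma> j) ` \<sigma> (Suc k) ` e)) ` ?B \<subseteq> ?A"
      proof (rule image_subsetI)
        fix j assume j: "j \<in> ?B"
        have jm: "j \<in> {1..m}" "Suc k \<in> {1..m}" using j k by auto
        have "inv (\<sigma> j) ` \<sigma> (Suc k) ` e \<in> ?E"
          using jm e by (intro image_in_K_edges permutes_inv p)
        moreover have "\<sigma> j ` inv (\<sigma> j) ` \<sigma> (Suc k) ` e = \<sigma> (Suc k) ` e"
          by (rule image_inv_permutes(1)[OF p[OF jm(1)]])
        moreover have "\<sigma>' j ` inv (\<sigma> j) ` \<sigma> (Suc k) ` e = \<sigma>' (Suc k) ` e"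
          using j S by (simp only: mem_Collect_eq image_comp[symmetric])
        ultimately show "(j, inv (\<sigma> j) ` \<sigma> (Suc k) ` e) \<in> ?A"
          using j unfolding fiber_def by blast
      qed
    qed
    then show ?thesis unfolding overlap_def by (rule bij_betw_same_card)
  qed
  have layer: "(\<Sum>e\<in>?E. real (overlap k e)) = (\<Sum>j\<in>{1..k}. F j (Suc k))" if k: "k < m" for k
  proof -
    have "(\<Sum>e\<in>?E. real (overlap k e)) = (\<Sum>e\<in>?E. \<Sum>j\<in>{1..k}.
        of_bool ((\<sigma>' j \<circ> inv (\<sigma> j)) ` (\<sigma> (Suc k) ` e) = (\<sigma>' (Suc k) \<circ> inv (\<sigma> (Suc k))) ` (\<sigma> (Suc k) ` e)))"
      using overlap[OF k] by (intro sum.cong refl) (simp add: Int_def)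
    also have "\<dots> = (\<Sum>f\<in>?E. \<Sum>j\<in>{1..k}.
        of_bool ((\<sigma>' j \<circ> inv (\<sigma> j)) ` f = (\<sigma>' (Suc k) \<circ> inv (\<sigma> (Suc k))) ` f))"
      by (rule sum.reindex_bij_betw[OF bij_a, of "Suc k"]) (use k in auto)
    also have "\<dots> = (\<Sum>j\<in>{1..k}. F j (Suc k))"
      unfolding F_def using finE by (subst sum.swap) (simp add: Int_def)
    finally show ?thesis .
  qed
  \<comment> \<open>\<open>F\<close> is symmetric, so the sum over unordered pairs is half of the
    sum over ordered pairs; the latter is the form of \<open>sum_PiE_exp_pairs_le\<close>.\<close>
  have pairs: "2 * (\<Sum>k<l. \<Sum>j\<in>{1..k}. F j (Suc k)) = (\<Sum>i\<in>{1..l}. \<Sum>j\<in>{1..l} - {i}. F i j)" for l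
  proof (induction l)
    case (Suc l)
    have "(\<Sum>i\<in>{1..Suc l}. \<Sum>j\<in>{1..Suc l} - {i}. F i j)
        = (\<Sum>i\<in>{1..l}. \<Sum>j\<in>{1..Suc l} - {i}. F i j) + (\<Sum>j\<in>{1..Suc l} - {Suc l}. F (Suc l) j)"
      by simp
    also have "{1..Suc l} - {Suc l} = {1..l}" by auto
    also have "(\<Sum>i\<in>{1..l}. \<Sum>j\<in>{1..Suc l} - {i}. F i j)
        = (\<Sum>i\<in>{1..l}. (\<Sum>j\<in>{1..l} - {i}. F i j) + F i (Suc l))"
    proof (rule sum.cong[OF refl])
      fix i assume "i \<in> {1..l}"
      then have "{1..Suc l} - {i} = insert (Suc l) ({1..l} - {i})" by auto
      then show "(\<Sum>j\<in>{1..Suc l} - {i}. F i j) = (\<Sum>j\<in>{1..l} - {i}. F i j) + F i (Suc l)"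
        by simp
    qed
    finally show ?case
      using Suc F_sym[of "Suc l"] by (simp add: sum.distrib)
  qed simp
  have "real (card {\<kappa> \<in> coloring_tuples m n C. rainbow_stacking m n \<kappa> \<sigma> \<and> rainbow_stacking m n \<kappa> \<sigma>'})
     \<le> (\<Prod>l<m. \<Prod>e\<in>?E. (real r - real l)\<^sup>2 / real r * exp (real (overlap l e) * y + \<epsilon>))"
    using card_proper_colorings_le[OF C le_refl]
    unfolding card_rainbow_pair_eq[OF \<sigma>] y_def \<epsilon>_def .
  also have "\<dots> = (\<Prod>l<m. ((real r - real l)\<^sup>2 / real r) ^ (n choose 2))
      * (exp (\<Sum>l<m. \<Sum>e\<in>?E. real (overlap l e) * y + \<epsilon>))"
    by (simp only: prod.distrib exp_sum finE finite_lessThan prod_constant card_K_edges)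
  also have "(\<Sum>l<m. \<Sum>e\<in>?E. real (overlap l e) * y + \<epsilon>)
      = y * (\<Sum>l<m. \<Sum>e\<in>?E. real (overlap l e)) + real (m * (n choose 2)) * \<epsilon>"
    by (simp add: sum.distrib sum_distrib_left card_K_edges mult_ac)
  also have "(\<Sum>l<m. \<Sum>e\<in>?E. real (overlap l e)) = (\<Sum>l<m. \<Sum>j\<in>{1..l}. F j (Suc l))"
    using layer by (intro sum.cong) auto
  also have "\<dots> = (\<Sum>i\<in>{1..m}. \<Sum>j\<in>{1..m} - {i}. F i j) / 2" using pairs[of m] by simp
  finally show ?thesis
    unfolding y_def[symmetric] \<epsilon>_def[symmetric] F_def[symmetric]
    by (simp add: exp_add prod_power_distrib algebra_simps)
qed

text \<open>For fixed \<open>\<sigma>\<close>, the tuple of relative permutations runs through all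
  stackings as \<open>\<sigma>'\<close> does, so the sum over \<open>\<sigma>'\<close> is bounded
  independently of \<open>\<sigma>\<close>. The first exponential collects the cubic errors of all
  vertices; the base of the power is the exponential moment of the fixed edges of one random
  permutation, and one such factor arises for each leaf of a star.\<close>

lemma card_no_rainbow_stacking_le:
  assumes m: "m \<ge> 1" and C: "finite C" "card C = r" "2 * m < r"
  shows "real (card {\<kappa> \<in> coloring_tuples m n C. \<not> (\<exists>\<sigma>. rainbow_stacking m n \<kappa> \<sigma>)})
    \<le> (exp (real (m * (n choose 2)) * (2 * real m ^ 3 / (real r - 2 * real m) ^ 3))
        * ((\<Sum>\<tau> | \<tau> permutes {1..n}. exp ((1 / real r + 1 / (real r - (real m - 1))) / 2 * real m / 2
              * real (card (fixed_edges n \<tau>)))) / fact n) ^ (m - 1) - 1)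
      * real (card (coloring_tuples m n C))"
proof -
  let ?P = "{p. p permutes {1..n}}" and ?\<Omega> = "coloring_tuples m n C" and ?S = "stackings m n"
  define y where "y = (1 / real r + 1 / (real r - (real m - 1))) / 2"
  define M where "M = exp (real (m * (n choose 2)) * (2 * real m ^ 3 / (real r - 2 * real m) ^ 3))"
  define Q where "Q = (\<Sum>\<tau>\<in>?P. exp (y * real m / 2 * real (card (fixed_edges n \<tau>))))"
  define p where "p = (\<Prod>l<m. (real r - real l) / real r) ^ (n choose 2)"
  define f where "f q q' = real (card {e \<in> K_edges n. q ` e = q' ` e})" for q q' :: "nat \<Rightarrow> nat"
  have finP: "finite ?P" and cardP: "card ?P = fact n"
    by (simp_all add: finite_permutations card_permutations)
  \<comment> \<open>Left translation by \<open>q\<close> turns agreement of \<open>q\<close> and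
    \<open>q'\<close> on an edge into an edge fixed by \<open>inv q \<circ> q'\<close>; hence the
    sum does not depend on the center.\<close>
  have Q: "(\<Sum>q'\<in>?P. exp (y * real (card {1..m}) / 2 * f q q')) = Q" if q: "q \<in> ?P" for q
  proof -
    have eq: "{e \<in> K_edges n. q ` e = (q \<circ> \<tau>) ` e} = fixed_edges n \<tau>" for \<tau>
    proof -
      have "q ` e = (q \<circ> \<tau>) ` e \<longleftrightarrow> \<tau> ` e = e" for e
        using q permutes_inj[of q] inj_image_eq_iff[of q e "\<tau> ` e"]
        unfolding image_comp[symmetric] mem_Collect_eq by blast
      then show ?thesis unfolding fixed_edges_def by auto
    qed
    have "bij_betw ((\<circ>) q) ?P ?P"
      using q permutes_inv_o[of q "{1..n}"]
      by (intro bij_betw_byWitness[where f' = "(\<circ>) (inv q)"])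
        (auto simp: comp_assoc[symmetric] intro: permutes_compose permutes_inv)
    then have "(\<Sum>q'\<in>?P. exp (y * real (card {1..m}) / 2 * f q q'))
       = (\<Sum>\<tau>\<in>?P. exp (y * real (card {1..m}) / 2 * f q (q \<circ> \<tau>)))"
      by (rule sum.reindex_bij_betw[symmetric])
    also have "\<dots> = Q" unfolding Q_def f_def eq by simp
    finally show ?thesis .
  qed
  have powers: "(\<Prod>l<m. (real r - real l)\<^sup>2 / real r) ^ (n choose 2) = p\<^sup>2 * real (card ?\<Omega>)"
  proof -
    have "(\<Prod>l<m. (real r - real l)\<^sup>2 / real r)
        = (\<Prod>l<m. ((real r - real l) / real r)\<^sup>2 * real r)"
      using C by (intro prod.cong) (auto simp: power2_eq_square)
    also have "\<dots> = (\<Prod>l<m. (real r - real l) / real r)\<^sup>2 * real r ^ m"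
      by (simp add: prod.distrib prod_power_distrib)
    finally have "(\<Prod>l<m. (real r - real l)\<^sup>2 / real r) ^ (n choose 2)
        = ((\<Prod>l<m. (real r - real l) / real r)\<^sup>2 * real r ^ m) ^ (n choose 2)" by simp
    also have "\<dots> = p\<^sup>2 * real (card ?\<Omega>)"
      unfolding p_def card_coloring_tuples C(2)
      by (simp add: power_mult_distrib power_mult[symmetric] mult.commute)
    finally show ?thesis .
  qed
  have first: "real (card {\<kappa> \<in> ?\<Omega>. rainbow_stacking m n \<kappa> \<sigma>}) = p * real (card ?\<Omega>)"
    if "\<sigma> \<in> ?S" for \<sigma>
  proof -
    have "real (card {\<kappa> \<in> ?\<Omega>. rainbow_stacking m n \<kappa> \<sigma>}) = (\<Prod>l<m. real r - real l) ^ (n choose 2)"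
      unfolding card_rainbow_eq[OF that C(1)] C(2) using C by (simp add: of_nat_diff)
    also have "(\<Prod>l<m. real r - real l) = (\<Prod>l<m. (real r - real l) / real r) * real r ^ m"
      using C by (simp add: prod_dividef)
    finally show ?thesis
      unfolding p_def card_coloring_tuples C(2)
      by (simp add: power_mult_distrib power_mult[symmetric] mult.commute)
  qed
  have second: "(\<Sum>\<sigma>'\<in>?S. real (card {\<kappa> \<in> ?\<Omega>. rainbow_stacking m n \<kappa> \<sigma> \<and> rainbow_stacking m n \<kappa> \<sigma>'}))
      \<le> p\<^sup>2 * real (card ?\<Omega>) * M * (fact n * Q ^ (m - 1))" if \<sigma>: "\<sigma> \<in> ?S" for \<sigma>
  proof -
    note ps = stackings_permutes[OF \<sigma>]
    have bij: "bij_betw (\<lambda>\<sigma>'. \<lambda>i\<in>{1..m}. \<sigma>' i \<circ> inv (\<sigma> i)) ?S ?S"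
    proof (rule bij_betw_byWitness[where f' = "\<lambda>\<sigma>'. \<lambda>i\<in>{1..m}. \<sigma>' i \<circ> \<sigma> i"])
      have inv: "inv (\<sigma> i) \<circ> \<sigma> i = id" "\<sigma> i \<circ> inv (\<sigma> i) = id" if "i \<in> {1..m}" for i
        using permutes_inv_o[OF ps[OF that]] by auto
      have c: "(q \<circ> inv (\<sigma> i)) \<circ> \<sigma> i = q" "(q \<circ> \<sigma> i) \<circ> inv (\<sigma> i) = q" if "i \<in> {1..m}"
        for i and q :: "nat \<Rightarrow> nat" using inv[OF that] by (simp_all add: comp_assoc)
      show "\<forall>\<sigma>'\<in>?S. (\<lambda>i\<in>{1..m}. (\<lambda>i\<in>{1..m}. \<sigma>' i \<circ> inv (\<sigma> i)) i \<circ> \<sigma> i) = \<sigma>'"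
        "\<forall>\<sigma>'\<in>?S. (\<lambda>i\<in>{1..m}. (\<lambda>i\<in>{1..m}. \<sigma>' i \<circ> \<sigma> i) i \<circ> inv (\<sigma> i)) = \<sigma>'"
        unfolding stackings_def using c
        by (auto simp: fun_eq_iff restrict_def PiE_def extensional_def)
      show "(\<lambda>\<sigma>'. \<lambda>i\<in>{1..m}. \<sigma>' i \<circ> inv (\<sigma> i)) ` ?S \<subseteq> ?S"
        "(\<lambda>\<sigma>'. \<lambda>i\<in>{1..m}. \<sigma>' i \<circ> \<sigma> i) ` ?S \<subseteq> ?S"
        using ps unfolding stackings_def
        by (auto simp: PiE_iff intro!: permutes_compose permutes_inv)
    qed
    let ?G = "\<lambda>\<rho>. exp (y / 2 * (\<Sum>i\<in>{1..m}. \<Sum>j\<in>{1..m} - {i}. f (\<rho> i) (\<rho> j)))"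
    have "(\<Sum>\<sigma>'\<in>?S. real (card {\<kappa> \<in> ?\<Omega>. rainbow_stacking m n \<kappa> \<sigma> \<and> rainbow_stacking m n \<kappa> \<sigma>'}))
       \<le> (\<Sum>\<sigma>'\<in>?S. p\<^sup>2 * real (card ?\<Omega>) * M * ?G (\<lambda>i\<in>{1..m}. \<sigma>' i \<circ> inv (\<sigma> i)))"
    proof (rule sum_mono)
      fix \<sigma>' assume \<sigma>': "\<sigma>' \<in> ?S"
      have "(\<Sum>i\<in>{1..m}. \<Sum>j\<in>{1..m} - {i}. f ((\<lambda>i\<in>{1..m}. \<sigma>' i \<circ> inv (\<sigma> i)) i) ((\<lambda>i\<in>{1..m}. \<sigma>' i \<circ> inv (\<sigma> i)) j))
          = (\<Sum>i\<in>{1..m}. \<Sum>j\<in>{1..m} - {i}. f (\<sigma>' i \<circ> inv (\<sigma> i)) (\<sigma>' j \<circ> inv (\<sigma> j)))"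
        by (intro sum.cong refl) auto
      then show "real (card {\<kappa> \<in> ?\<Omega>. rainbow_stacking m n \<kappa> \<sigma> \<and> rainbow_stacking m n \<kappa> \<sigma>'})
          \<le> p\<^sup>2 * real (card ?\<Omega>) * M * ?G (\<lambda>i\<in>{1..m}. \<sigma>' i \<circ> inv (\<sigma> i))"
        using card_rainbow_pair_le[OF \<sigma> \<sigma>' C]
        unfolding powers M_def[symmetric] y_def[symmetric] f_def[symmetric] by (simp only:)
    qed
    also have "\<dots> = (\<Sum>\<rho>\<in>?S. p\<^sup>2 * real (card ?\<Omega>) * M * ?G \<rho>)"
      by (rule sum.reindex_bij_betw[OF bij])
    also have "\<dots> = p\<^sup>2 * real (card ?\<Omega>) * M * (\<Sum>\<rho>\<in>?S. ?G \<rho>)" by (simp add: sum_distrib_left)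
    also have "\<dots> \<le> p\<^sup>2 * real (card ?\<Omega>) * M * (real (card ?P) * Q ^ (card {1..m} - 1))"
      unfolding stackings_def using m finP Q
      by (intro mult_left_mono sum_PiE_exp_pairs_le) (auto simp: M_def)
    finally show ?thesis unfolding cardP by simp
  qed
  have "real (card {\<kappa> \<in> ?\<Omega>. \<forall>\<sigma>\<in>?S. \<not> rainbow_stacking m n \<kappa> \<sigma>})
      \<le> (M * (Q / fact n) ^ (m - 1) - 1) * real (card ?\<Omega>)"
  proof (rule second_moment_count[where p = p])
    show "finite ?S" by (rule finite_stackings)
    then show "?S \<noteq> {}" using card_stackings[of m n] by force
    show "finite ?\<Omega>" using C(1) by (rule finite_coloring_tuples)
    show "p > 0" unfolding p_def using C by (intro zero_less_power prod_pos) auto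
    have "(\<Sum>\<sigma>\<in>?S. \<Sum>\<sigma>'\<in>?S. real (card {\<kappa> \<in> ?\<Omega>. rainbow_stacking m n \<kappa> \<sigma> \<and> rainbow_stacking m n \<kappa> \<sigma>'}))
       \<le> (\<Sum>\<sigma>\<in>?S. p\<^sup>2 * real (card ?\<Omega>) * M * (fact n * Q ^ (m - 1)))"
      using second by (rule sum_mono)
    also have "\<dots> = fact n ^ m * (p\<^sup>2 * real (card ?\<Omega>) * M * (fact n * Q ^ (m - 1)))"
      by (simp add: card_stackings)
    also have "fact n * Q ^ (m - 1) = fact n ^ m * (Q / fact n) ^ (m - 1)"
      using m by (cases m) (auto simp: power_divide)
    finally show "(\<Sum>\<sigma>\<in>?S. \<Sum>\<sigma>'\<in>?S. real (card {\<kappa> \<in> ?\<Omega>. rainbow_stacking m n \<kappa> \<sigma> \<and> rainbow_stacking m n \<kappa> \<sigma>'}))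
       \<le> (1 + (M * (Q / fact n) ^ (m - 1) - 1)) * (p * real (card ?S))\<^sup>2 * real (card ?\<Omega>)"
      by (simp add: card_stackings power2_eq_square mult_ac)
  qed (use first in auto)
  moreover have "(\<forall>\<sigma>\<in>?S. \<not> rainbow_stacking m n \<kappa> \<sigma>) \<longleftrightarrow> \<not> (\<exists>\<sigma>. rainbow_stacking m n \<kappa> \<sigma>)"
    for \<kappa> :: "nat \<Rightarrow> nat set \<Rightarrow> 'a"
    unfolding rainbow_stacking_def stackings_def by blast
  ultimately show ?thesis unfolding M_def Q_def y_def by simp
qed

section \<open>Exponential moments of the number of fixed edges of a permutation\<close>

text \<open>Composition with the inverse of one such permutation embeds all of them into the
  permutations of \<open>A - B\<close>.\<close>

lemma card_permutes_agree_le: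
  assumes A: "finite A" "B \<subseteq> A"
  shows "card {p. p permutes A \<and> (\<forall>x\<in>B. p x = q x)} \<le> fact (card A - card B)"
proof (cases "\<exists>p. p permutes A \<and> (\<forall>x\<in>B. p x = q x)")
  case True
  then obtain p0 where p0: "p0 permutes A" "\<And>x. x \<in> B \<Longrightarrow> p0 x = q x" by blast
  have "card {p. p permutes A \<and> (\<forall>x\<in>B. p x = q x)} \<le> card {p. p permutes (A - B)}"
  proof (rule card_inj_on_le[where f = "\<lambda>p. inv p0 \<circ> p"])
    show "inj_on (\<lambda>p. inv p0 \<circ> p) {p. p permutes A \<and> (\<forall>x\<in>B. p x = q x)}"
    proof (rule inj_onI)
      fix p p' assume "inv p0 \<circ> p = inv p0 \<circ> p'"
      then have "p0 \<circ> (inv p0 \<circ> p) = p0 \<circ> (inv p0 \<circ> p')" by simp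
      then show "p = p'" using permutes_inv_o(1)[OF p0(1)] by (simp add: o_assoc)
    qed
    show "(\<lambda>p. inv p0 \<circ> p) ` {p. p permutes A \<and> (\<forall>x\<in>B. p x = q x)} \<subseteq> {p. p permutes (A - B)}"
    proof (rule image_subsetI)
      fix p assume p: "p \<in> {p. p permutes A \<and> (\<forall>x\<in>B. p x = q x)}"
      then have "inv p0 \<circ> p permutes A"
        using p0(1) by (auto intro: permutes_compose permutes_inv)
      moreover have "(inv p0 \<circ> p) x = x" if "x \<in> B" for x
        using p p0(2)[OF that] that permutes_inverses(2)[OF p0(1), of x] by simp
      ultimately show "inv p0 \<circ> p \<in> {p. p permutes (A - B)}"
        by (auto intro!: permutes_superset[of _ A])
    qed
    show "finite {p. p permutes (A - B)}" using A by (simp add: finite_permutations)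
  qed
  also have "\<dots> = fact (card A - card B)"
    using A by (simp add: card_permutations card_Diff_subset finite_subset)
  finally show ?thesis .
next
  case False
  then have "{p. p permutes A \<and> (\<forall>x\<in>B. p x = q x)} = {}" by blast
  then show ?thesis by (simp only: card.empty)
qed

section \<open>Fixed points, 2-cycles and fixed edges\<close>

definition fixed_points :: "nat \<Rightarrow> (nat \<Rightarrow> nat) \<Rightarrow> nat set" where
  "fixed_points n p = {x \<in> {1..n}. p x = x}"

definition swapped_points :: "nat \<Rightarrow> (nat \<Rightarrow> nat) \<Rightarrow> nat set" where
  "swapped_points n p = {x \<in> {1..n}. p x \<noteq> x \<and> p (p x) = x}"

lemma finite_fixed_swapped: "finite (fixed_points n p)" "finite (swapped_points n p)"
  by (simp_all add: fixed_points_def swapped_points_def)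

lemma card_fixed_swapped_le: "card (fixed_points n p) + card (swapped_points n p) \<le> n"
proof -
  have "card (fixed_points n p \<union> swapped_points n p) \<le> card {1..n}"
    by (intro card_mono) (auto simp: fixed_points_def swapped_points_def)
  moreover have "fixed_points n p \<inter> swapped_points n p = {}"
    by (auto simp: fixed_points_def swapped_points_def)
  ultimately show ?thesis using finite_fixed_swapped by (simp add: card_Un_disjoint)
qed

text \<open>The endpoints of a fixed edge are either both fixed or form a 2-cycle, and each 2-cycle
  accounts for two swapped points.\<close>

lemma card_fixed_edges_le:
  assumes p: "p permutes {1..n}"
  shows "2 * card (fixed_edges n p)
    \<le> card (fixed_points n p) * (card (fixed_points n p) - 1) + card (swapped_points n p)"
proof -
  let ?F = "fixed_points n p" and ?S = "swapped_points n p"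
  let ?h = "\<lambda>x. {x, p x}"
  have "fixed_edges n p \<subseteq> nsets ?F 2 \<union> ?h ` ?S"
  proof
    fix e assume e: "e \<in> fixed_edges n p"
    then obtain x y where xy: "e = {x, y}" "x \<noteq> y" "x \<in> {1..n}" "y \<in> {1..n}" "{p x, p y} = {x, y}"
      unfolding fixed_edges_def K_edges_def by (auto elim!: nsets2_E)
    then consider "p x = x" "p y = y" | "p x = y" "p y = x" by (auto simp: doubleton_eq_iff)
    then show "e \<in> nsets ?F 2 \<union> ?h ` ?S"
    proof cases
      case 1
      then show ?thesis using xy by (auto simp: fixed_points_def)
    next
      case 2
      then have "x \<in> ?S" using xy by (auto simp: swapped_points_def)
      then show ?thesis using 2 xy by blast
    qed
  qed
  then have "card (fixed_edges n p) \<le> card (nsets ?F 2 \<union> ?h ` ?S)"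
    using finite_fixed_swapped by (intro card_mono) (auto simp: finite_imp_finite_nsets)
  also have "\<dots> \<le> card (nsets ?F 2) + card (?h ` ?S)" by (rule card_Un_le)
  also have "card (nsets ?F 2) = card ?F choose 2"
  proof -
    have "nsets ?F 2 = {e. e \<subseteq> ?F \<and> card e = 2}"
      unfolding nsets_def using finite_fixed_swapped by (auto intro: finite_subset)
    then show ?thesis using n_subsets[OF finite_fixed_swapped(1)] by simp
  qed
  finally have le: "card (fixed_edges n p) \<le> (card ?F choose 2) + card (?h ` ?S)" .
  have "2 * card (?h ` ?S) = (\<Sum>e\<in>?h ` ?S. 2)" by simp
  also have "\<dots> \<le> (\<Sum>e\<in>?h ` ?S. card {x \<in> ?S. ?h x = e})"
  proof (rule sum_mono)
    fix e assume "e \<in> ?h ` ?S"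
    then obtain x where x: "x \<in> ?S" "e = ?h x" by blast
    have "p x \<in> {1..n}" using x permutes_in_image[OF p, of x] by (auto simp: swapped_points_def)
    then have "{x, p x} \<subseteq> {x \<in> ?S. ?h x = e}"
      using x by (auto simp: swapped_points_def)
    then have "card {x, p x} \<le> card {x \<in> ?S. ?h x = e}"
      using finite_fixed_swapped by (intro card_mono) auto
    then show "2 \<le> card {x \<in> ?S. ?h x = e}" using x by (auto simp: swapped_points_def)
  qed
  also have "\<dots> = card ?S"
    using sum.image_gen[OF finite_fixed_swapped(2), of "\<lambda>_. 1 :: nat" n p ?h] by simp
  finally have "2 * card (?h ` ?S) \<le> card ?S" .
  moreover have "2 * (card ?F choose 2) \<le> card ?F * (card ?F - 1)" by (simp add: choose_two)
  ultimately show ?thesis using le by linarith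
qed

text \<open>A second factorial moment: \<open>s * (s - 2)\<close> counts ordered pairs of swapped
  points on different 2-cycles. Such a pair and its images are four points, giving at most
  \<open>n ^ 4\<close> patterns, each realized by at most \<open>fact (n - 4)\<close> permutations.
  Compared with a first moment, this makes the tail of \<open>s\<close> quadratically small.\<close>

lemma sum_swapped_points_le:
  "(\<Sum>p | p permutes {1..n}. card (swapped_points n p) * (card (swapped_points n p) - 2)) \<le> n ^ 4 * fact (n - 4)"
proof -
  let ?P = "{p. p permutes {1..n}}" and ?I = "{1..n}"
  let ?W = "\<lambda>p (x, x', y, y'). distinct [x, x', y, y'] \<and> p x = x' \<and> p x' = x \<and> p y = y' \<and> p y' = y"
  let ?T = "?I \<times> ?I \<times> ?I \<times> ?I"
  have finP: "finite ?P" by (simp add: finite_permutations)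
  have one: "card (swapped_points n p) * (card (swapped_points n p) - 2) \<le> card {t \<in> ?T. ?W p t}"
    if p: "p \<in> ?P" for p
  proof -
    let ?S = "swapped_points n p"
    have pS: "p x \<in> ?S" if "x \<in> ?S" for x
      using that p permutes_in_image[of p ?I x] by (auto simp: swapped_points_def)
    have "card ?S * (card ?S - 2) = (\<Sum>x\<in>?S. card (?S - {x, p x}))"
    proof -
      have "card (?S - {x, p x}) = card ?S - 2" if "x \<in> ?S" for x
        using that pS[OF that] by (subst card_Diff_subset) (auto simp: swapped_points_def)
      then show ?thesis by simp
    qed
    also have "\<dots> = card (SIGMA x:?S. ?S - {x, p x})"
      using finite_fixed_swapped by (simp add: card_SigmaI)
    also have "\<dots> \<le> card {t \<in> ?T. ?W p t}"
    proof (rule card_inj_on_le[where f = "\<lambda>(x, y). (x, p x, y, p y)"])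
      show "inj_on (\<lambda>(x, y). (x, p x, y, p y)) (SIGMA x:?S. ?S - {x, p x})"
        by (auto simp: inj_on_def)
      show "(\<lambda>(x, y). (x, p x, y, p y)) ` (SIGMA x:?S. ?S - {x, p x}) \<subseteq> {t \<in> ?T. ?W p t}"
      proof (rule image_subsetI)
        fix u assume "u \<in> (SIGMA x:?S. ?S - {x, p x})"
        then obtain x y where u: "u = (x, y)" and x: "x \<in> ?S" and y: "y \<in> ?S" "y \<notin> {x, p x}" by blast
        then have "p x \<noteq> x" "p y \<noteq> y" "p (p x) = x" "p (p y) = y" "x \<in> ?I" "y \<in> ?I" "p x \<in> ?I" "p y \<in> ?I"
          using pS[of x] pS[of y] by (auto simp: swapped_points_def)
        moreover from this have "p y \<noteq> x" "p x \<noteq> p y" using y(2) by auto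
        ultimately show "(case u of (x, y) \<Rightarrow> (x, p x, y, p y)) \<in> {t \<in> ?T. ?W p t}"
          using y(2) unfolding u by auto
      qed
    qed auto
    finally show ?thesis .
  qed
  have "(\<Sum>p\<in>?P. card (swapped_points n p) * (card (swapped_points n p) - 2))
      \<le> (\<Sum>p\<in>?P. card {t \<in> ?T. ?W p t})" using one by (rule sum_mono)
  also have "\<dots> = (\<Sum>p\<in>?P. \<Sum>t\<in>?T. of_bool (?W p t))" by (intro sum.cong refl) (simp add: Int_def)
  also have "\<dots> = (\<Sum>t\<in>?T. \<Sum>p\<in>?P. of_bool (?W p t))" by (rule sum.swap)
  also have "\<dots> \<le> (\<Sum>t\<in>?T. fact (n - 4))"
  proof (rule sum_mono)
    fix t assume "t \<in> ?T"
    then obtain x x' y y' where t: "t = (x, x', y, y')" "{x, x', y, y'} \<subseteq> ?I" by auto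
    have "(\<Sum>p\<in>?P. of_bool (?W p t)) = card {p \<in> ?P. ?W p t}"
      using finP by (simp add: Int_def)
    also have "\<dots> \<le> fact (n - 4)"
    proof (cases "distinct [x, x', y, y']")
      case True
      let ?q = "(\<lambda>_. 0)(x := x', x' := x, y := y', y' := y)"
      have "{p \<in> ?P. ?W p t} \<subseteq> {p. p permutes ?I \<and> (\<forall>z\<in>{x, x', y, y'}. p z = ?q z)}"
        unfolding t using True by auto
      then have "card {p \<in> ?P. ?W p t} \<le> card {p. p permutes ?I \<and> (\<forall>z\<in>{x, x', y, y'}. p z = ?q z)}"
        by (rule card_mono[rotated]) (simp add: finite_permutations)
      also have "\<dots> \<le> fact (card ?I - card {x, x', y, y'})"
        using t(2) by (intro card_permutes_agree_le) auto
      also have "card {x, x', y, y'} = 4" using True by auto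
      finally show ?thesis by simp
    next
      case False
      then have "{p \<in> ?P. ?W p t} = {}" unfolding t by (simp only: prod.case simp_thms) simp
      then show ?thesis by (simp only: card.empty)
    qed
    finally show "(\<Sum>p\<in>?P. of_bool (?W p t)) \<le> (fact (n - 4) :: nat)" by simp
  qed
  also have "\<dots> = n ^ 4 * fact (n - 4)" by (simp add: card_cartesian_product eval_nat_numeral)
  finally show ?thesis .
qed

text \<open>A union bound over the possible sets of fixed points, since \<open>n choose k\<close>
  times \<open>fact (n - k)\<close> is \<open>fact n / fact k\<close>.\<close>

lemma card_permutes_fixed_points_le:
  assumes "k \<le> n"
  shows "real (card {p. p permutes {1..n} \<and> card (fixed_points n p) = k}) \<le> fact n / fact k"
proof -
  let ?A = "{A. A \<subseteq> {1..n} \<and> card A = k}"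
  let ?B = "\<lambda>A. {p. p permutes {1..n} \<and> (\<forall>x\<in>A. p x = id x)}"
  have finA: "finite ?A" by simp
  have finB: "finite (?B A)" for A by (simp add: finite_permutations)
  have "{p. p permutes {1..n} \<and> card (fixed_points n p) = k} \<subseteq> (\<Union>A\<in>?A. ?B A)"
  proof
    fix p assume "p \<in> {p. p permutes {1..n} \<and> card (fixed_points n p) = k}"
    then show "p \<in> (\<Union>A\<in>?A. ?B A)"
      by (intro UN_I[of "fixed_points n p"]) (auto simp: fixed_points_def)
  qed
  then have "card {p. p permutes {1..n} \<and> card (fixed_points n p) = k} \<le> card (\<Union>A\<in>?A. ?B A)"
    using finA finB by (intro card_mono) blast
  also have "\<dots> \<le> (\<Sum>A\<in>?A. card (?B A))" using finA by (rule card_UN_le)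
  also have "\<dots> \<le> (\<Sum>A\<in>?A. fact (n - k))"
  proof (rule sum_mono)
    fix A assume A: "A \<in> ?A"
    have "card (?B A) \<le> fact (card {1..n} - card A)"
      using A by (intro card_permutes_agree_le) auto
    then show "card (?B A) \<le> fact (n - k)" using A by simp
  qed
  also have "\<dots> = (n choose k) * fact (n - k)" using n_subsets[of "{1..n}" k] by simp
  finally have "real (card {p. p permutes {1..n} \<and> card (fixed_points n p) = k})
      \<le> real ((n choose k) * fact (n - k))" by (simp only: of_nat_le_iff)
  also have "\<dots> = fact n / fact k" using assms by (simp add: binomial_fact)
  finally show ?thesis .
qed

text \<open>The three terms treat permutations with at most \<open>K\<close> fixed and at most
  \<open>J\<close> swapped points, those with at most \<open>K\<close> fixed but more than
  \<open>J\<close> swapped points, and those with more than \<open>K\<close> fixed points. In the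
  second case \<open>s * (s - 2) / (J * (J - 2)) \<ge> 1\<close> is inserted, as in Markov's
  inequality; in the third the \<open>n - k\<close> other points are all counted as if they were
  swapped.\<close>

lemma sum_exp_fixed_edges_le:
  fixes \<beta> K J :: real
  assumes \<beta>: "\<beta> \<ge> 0" and K: "K \<ge> 0" and J: "J > 2" and n: "n \<ge> 4"
  shows "(\<Sum>p | p permutes {1..n}. exp (\<beta> * real (card (fixed_edges n p)))) / fact n
    \<le> exp (\<beta> * (K\<^sup>2 + J) / 2)
      + real (n ^ 4 * fact (n - 4)) / fact n / (J * (J - 2)) * exp (\<beta> * (K\<^sup>2 + real n) / 2)
      + (\<Sum>k | k \<le> n \<and> K < real k. exp (\<beta> * (real k * (real k - 1) + (real n - real k)) / 2) / fact k)"
proof -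
  let ?P = "{p. p permutes {1..n}}"
  define k where "k p = card (fixed_points n p)" for p
  define s where "s p = card (swapped_points n p)" for p
  let ?g = "\<lambda>k. exp (\<beta> * (real k * (real k - 1) + (real n - real k)) / 2)"
  have finP: "finite ?P" by (simp add: finite_permutations)
  have ks: "k p + s p \<le> n" for p unfolding k_def s_def by (rule card_fixed_swapped_le)
  have F: "2 * real (card (fixed_edges n p)) \<le> real (k p) * (real (k p) - 1) + real (s p)" if "p \<in> ?P" for p
  proof -
    have "2 * card (fixed_edges n p) \<le> k p * (k p - 1) + s p"
      using card_fixed_edges_le[of p n] that unfolding k_def s_def by simp
    then have "real (2 * card (fixed_edges n p)) \<le> real (k p * (k p - 1) + s p)"
      by (simp only: of_nat_le_iff)
    moreover have "real (k p * (k p - 1)) = real (k p) * (real (k p) - 1)"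
      by (cases "k p") (simp_all add: algebra_simps)
    ultimately show ?thesis by (simp only: of_nat_add of_nat_mult of_nat_numeral)
  qed
  have E: "exp (\<beta> * real (card (fixed_edges n p))) \<le> exp (\<beta> * b / 2)"
    if "p \<in> ?P" "real (k p) * (real (k p) - 1) + real (s p) \<le> b" for p b
  proof -
    have "\<beta> * (2 * real (card (fixed_edges n p))) \<le> \<beta> * b"
      using F[OF that(1)] that(2) \<beta> by (intro mult_left_mono) auto
    then show ?thesis by simp
  qed
  have point: "exp (\<beta> * real (card (fixed_edges n p))) \<le> exp (\<beta> * (K\<^sup>2 + J) / 2)
      + real (s p * (s p - 2)) / (J * (J - 2)) * exp (\<beta> * (K\<^sup>2 + real n) / 2)
      + of_bool (K < real (k p)) * ?g (k p)" if p: "p \<in> ?P" for p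
  proof (cases "K < real (k p)")
    case True
    have "exp (\<beta> * real (card (fixed_edges n p))) \<le> ?g (k p)"
      using ks[of p] by (intro E p) linarith
    then show ?thesis using True J by (simp add: add_increasing)
  next
    case False
    have k2: "real (k p) * (real (k p) - 1) \<le> K\<^sup>2"
    proof -
      have "real (k p) * (real (k p) - 1) \<le> real (k p) * real (k p)" by (intro mult_left_mono) auto
      also have "\<dots> \<le> K * K" using False K by (intro mult_mono) auto
      finally show ?thesis by (simp add: power2_eq_square)
    qed
    show ?thesis
    proof (cases "real (s p) \<le> J")
      case True
      have "exp (\<beta> * real (card (fixed_edges n p))) \<le> exp (\<beta> * (K\<^sup>2 + J) / 2)"
        using k2 True by (intro E p) linarith
      then show ?thesis using J False by (simp add: add_increasing2)
    next
      case False2: False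
      have "J * (J - 2) \<le> real (s p) * (real (s p) - 2)"
        using False2 J by (intro mult_mono) auto
      also have "\<dots> = real (s p * (s p - 2))" using False2 J by (simp add: of_nat_diff)
      finally have z: "1 \<le> real (s p * (s p - 2)) / (J * (J - 2))"
        using J by (simp only: le_divide_eq_1_pos mult_pos_pos diff_gt_0_iff_gt)
      have "exp (\<beta> * real (card (fixed_edges n p))) \<le> exp (\<beta> * (K\<^sup>2 + real n) / 2)"
        using k2 ks[of p] by (intro E p) linarith
      then have "1 * exp (\<beta> * real (card (fixed_edges n p)))
          \<le> real (s p * (s p - 2)) / (J * (J - 2)) * exp (\<beta> * (K\<^sup>2 + real n) / 2)"
        using order_trans[OF zero_le_one z] by (intro mult_mono z) simp_all
      then show ?thesis using False by (simp add: add_increasing)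
    qed
  qed
  have last: "(\<Sum>p\<in>?P. of_bool (K < real (k p)) * ?g (k p))
      \<le> (\<Sum>j | j \<le> n \<and> K < real j. fact n / fact j * ?g j)"
  proof -
    have "(\<Sum>p\<in>?P. of_bool (K < real (k p)) * ?g (k p))
        = (\<Sum>p\<in>?P. \<Sum>j\<in>{..n}. if j = k p then of_bool (K < real j) * ?g j else 0)"
      using ks by (intro sum.cong refl) (auto simp: sum.delta' intro: le_trans[OF le_add1])
    also have "\<dots> = (\<Sum>j\<in>{..n}. \<Sum>p\<in>?P. if j = k p then of_bool (K < real j) * ?g j else 0)"
      by (rule sum.swap)
    also have "\<dots> = (\<Sum>j\<in>{..n}. real (card {p. p permutes {1..n} \<and> k p = j}) * (of_bool (K < real j) * ?g j))"
    proof (rule sum.cong[OF refl])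
      fix j
      have "(\<Sum>p\<in>?P. if j = k p then of_bool (K < real j) * ?g j else 0)
          = (\<Sum>p\<in>{p\<in>?P. j = k p}. of_bool (K < real j) * ?g j)"
        using finP by (rule sum.inter_filter[symmetric])
      also have "{p\<in>?P. j = k p} = {p. p permutes {1..n} \<and> k p = j}" by auto
      finally show "(\<Sum>p\<in>?P. if j = k p then of_bool (K < real j) * ?g j else 0)
          = real (card {p. p permutes {1..n} \<and> k p = j}) * (of_bool (K < real j) * ?g j)" by simp
    qed
    also have "\<dots> \<le> (\<Sum>j\<in>{..n}. fact n / fact j * (of_bool (K < real j) * ?g j))"
      unfolding k_def by (intro sum_mono mult_right_mono card_permutes_fixed_points_le) auto
    also have "\<dots> = (\<Sum>j\<in>{..n}. if K < real j then fact n / fact j * ?g j else 0)"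
      by (intro sum.cong) auto
    also have "\<dots> = (\<Sum>j\<in>{j\<in>{..n}. K < real j}. fact n / fact j * ?g j)"
      by (rule sum.inter_filter[symmetric]) simp
    finally show ?thesis by simp
  qed
  have "(\<Sum>p\<in>?P. exp (\<beta> * real (card (fixed_edges n p))))
    \<le> (\<Sum>p\<in>?P. exp (\<beta> * (K\<^sup>2 + J) / 2)
      + real (s p * (s p - 2)) / (J * (J - 2)) * exp (\<beta> * (K\<^sup>2 + real n) / 2)
      + of_bool (K < real (k p)) * ?g (k p))"
    using point by (rule sum_mono)
  also have "\<dots> = fact n * exp (\<beta> * (K\<^sup>2 + J) / 2)
      + real (\<Sum>p\<in>?P. s p * (s p - 2)) / (J * (J - 2)) * exp (\<beta> * (K\<^sup>2 + real n) / 2)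
      + (\<Sum>p\<in>?P. of_bool (K < real (k p)) * ?g (k p))"
    by (simp add: sum.distrib card_permutations sum_divide_distrib sum_distrib_right)
  also have "\<dots> \<le> fact n * exp (\<beta> * (K\<^sup>2 + J) / 2)
      + real (n ^ 4 * fact (n - 4)) / (J * (J - 2)) * exp (\<beta> * (K\<^sup>2 + real n) / 2)
      + (\<Sum>j | j \<le> n \<and> K < real j. fact n / fact j * ?g j)"
    using J sum_swapped_points_le[of n] last unfolding s_def
    by (intro add_mono mult_right_mono divide_right_mono) (auto simp only: of_nat_le_iff, auto)
  also have "(\<Sum>j | j \<le> n \<and> K < real j. fact n / fact j * ?g j)
      = fact n * (\<Sum>j | j \<le> n \<and> K < real j. ?g j / fact j)"
    by (simp add: sum_distrib_left)
  finally have "(\<Sum>p\<in>?P. exp (\<beta> * real (card (fixed_edges n p)))) / fact n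
      \<le> (fact n * exp (\<beta> * (K\<^sup>2 + J) / 2)
      + real (n ^ 4 * fact (n - 4)) / (J * (J - 2)) * exp (\<beta> * (K\<^sup>2 + real n) / 2)
      + fact n * (\<Sum>j | j \<le> n \<and> K < real j. ?g j / fact j)) / fact n"
    by (rule divide_right_mono) simp
  then show ?thesis by (simp add: add_divide_distrib mult_ac)
qed

section \<open>Asymptotics\<close>

lemma ln_fact_bounds:
  assumes "n \<ge> 1"
  shows "real n * ln (real n) - real n \<le> ln (fact n)" "ln (fact n) \<le> real n * ln (real n)"
proof -
  show "real n * ln (real n) - real n \<le> ln (fact n)"
    using assms
  proof (induction n rule: nat_induct_at_least)
    case base
    then show ?case by simp
  next
    case (Suc n)
    have n: "real n > 0" using Suc.hyps by simp
    have "ln (real (Suc n)) - ln (real n) = ln (1 + 1 / real n)"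
      using n ln_divide_pos[of "real (Suc n)" "real n"] by (simp add: add_divide_distrib add.commute)
    also have "\<dots> \<le> 1 / real n" using n by (intro ln_add_one_self_le_self) auto
    finally have "real n * (ln (real (Suc n)) - ln (real n)) \<le> real n * (1 / real n)"
      using n by (intro mult_left_mono) auto
    then have "real n * ln (real (Suc n)) \<le> real n * ln (real n) + 1" using n by (simp add: algebra_simps)
    moreover have "ln (fact (Suc n) :: real) = ln (real (Suc n)) + ln (fact n)"
      by (simp only: fact_Suc of_nat_mult ln_mult_pos fact_gt_zero of_nat_0_less_iff zero_less_Suc)
    ultimately show ?case using Suc.IH by (simp add: algebra_simps)
  qed
  have "ln (fact n :: real) \<le> ln (real n ^ n)"
  proof (rule ln_mono)
    show "fact n \<le> real n ^ n" using fact_le_power[of n, where ?'a = real] by simp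
  qed auto
  then show "ln (fact n) \<le> real n * ln (real n)" using assms by (simp add: ln_realpow)
qed

lemma real_choose_2: "real (n choose 2) = real n * (real n - 1) / 2"
proof -
  have "even (n * (n - 1))" by (cases n) auto
  then have "2 * (n choose 2) = n * (n - 1)" unfolding choose_two by (rule dvd_mult_div_cancel)
  then have "real (2 * (n choose 2)) = real (n * (n - 1))" by (simp only:)
  then show ?thesis by (cases n) (simp_all add: field_simps)
qed

section \<open>The exponential moment at the critical exponent\<close>

text \<open>The exponent at which the identity contributes \<open>n powr (- 3)\<close> to the exponential moment.\<close>

definition critical_exponent :: "nat \<Rightarrow> real" where
  "critical_exponent n = (ln (fact n) - 3 * ln (real n)) / real (n choose 2)"

text \<open>The hypothesis \<open>big\<close> says that \<open>n * ln n - n - 3 * ln n\<close> is at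
  least half of \<open>n * ln n\<close>.\<close>

lemma critical_exponent_bounds:
  assumes n: "n \<ge> 2" and big: "real n * ln (real n) \<ge> 2 * real n + 6 * ln (real n)"
  shows "ln (real n) / real n \<le> critical_exponent n"
    and "critical_exponent n \<le> 2 * ln (real n) / (real n - 1)"
proof -
  have pos: "real n > 1" "ln (real n) > 0" using n by auto
  have "ln (real n) / real n = (real n * ln (real n) / 2) / (real n * real n / 2)"
    using pos by simp
  also have "\<dots> \<le> (real n * ln (real n) / 2) / (real n * (real n - 1) / 2)"
    using pos by (intro divide_left_mono divide_right_mono mult_left_mono mult_pos_pos divide_pos_pos) auto
  also have "\<dots> \<le> (ln (fact n) - 3 * ln (real n)) / (real n * (real n - 1) / 2)"
    using ln_fact_bounds(1)[of n] n big pos by (intro divide_right_mono) auto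
  finally show "ln (real n) / real n \<le> critical_exponent n"
    unfolding critical_exponent_def real_choose_2 .
  have "critical_exponent n \<le> (real n * ln (real n)) / (real n * (real n - 1) / 2)"
    unfolding critical_exponent_def real_choose_2
  proof (rule divide_right_mono)
    show "ln (fact n) - 3 * ln (real n) \<le> real n * ln (real n)"
      using ln_fact_bounds(2)[of n] n pos(2) by linarith
  qed (use pos in auto)
  also have "\<dots> = 2 * ln (real n) / (real n - 1)" using pos by simp
  finally show "critical_exponent n \<le> 2 * ln (real n) / (real n - 1)" .
qed

text \<open>The increments are monotone: if the one at \<open>k\<close> is nonpositive, so are all
  earlier ones; if it is positive, so are all later ones.\<close>

lemma discrete_convex_le_max:
  fixes h :: "nat \<Rightarrow> real"
  assumes conv: "\<And>k. a \<le> k \<Longrightarrow> h (Suc k) - h k \<le> h (Suc (Suc k)) - h (Suc k)"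
    and k: "a \<le> k" "k \<le> b"
  shows "h k \<le> max (h a) (h b)"
proof -
  define D where "D i = h (Suc i) - h i" for i
  have mono: "D i \<le> D j" if "a \<le> i" "i \<le> j" for i j
    using that(2,1) conv by (induction rule: dec_induct) (auto simp: D_def intro: order_trans)
  show ?thesis
  proof (cases "D k \<le> 0")
    case True
    have "h k \<le> h a"
    proof -
      have "h i \<le> h a" if "a \<le> i" "i \<le> k" for i
        using that
      proof (induction rule: dec_induct)
        case (step i)
        then show ?case using mono[of i k] True by (simp add: D_def)
      qed simp
      then show ?thesis using k by simp
    qed
    then show ?thesis by simp
  next
    case False
    have "h k \<le> h b"
      using k(2)
    proof (induction rule: dec_induct)
      case (step i)
      then show ?case using mono[of k i] k(1) False by (simp add: D_def)
    qed simp
    then show ?thesis by simp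
  qed
qed

text \<open>The exponent is bounded directly for \<open>k\<close> up to about \<open>n / ln n\<close>; beyond that it is a convex
  function of \<open>k\<close>, with value \<open>- 3 * ln n\<close> at \<open>k = n\<close>.\<close>

lemma fixed_points_exponent_le:
  assumes n: "n \<ge> 2" and big: "real n * ln (real n) \<ge> 2 * real n + 6 * ln (real n)"
    and ll: "ln (ln (real n)) \<ge> 7" and gap: "real n / ln (real n) > ln (real n) + 1"
    and k: "ln (real n) < real k" "k \<le> n"
  shows "critical_exponent n * (real k * (real k - 1) + (real n - real k)) / 2 - ln (fact k)
    \<le> - 2 * ln (real n)"
proof -
  define l where "l = ln (real n)"
  define \<beta> where "\<beta> = critical_exponent n"
  define h where "h k = \<beta> * (real k * (real k - 1) + (real n - real k)) / 2 - ln (fact k)" for k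
  have l: "l > 0" using n unfolding l_def by simp
  have n1: "real n > 1" using n by simp
  have \<beta>: "l / real n \<le> \<beta>" "\<beta> \<le> 2 * l / (real n - 1)"
    unfolding l_def \<beta>_def using critical_exponent_bounds[OF n big] by auto
  have \<beta>0: "\<beta> \<ge> 0" by (rule order_trans[OF _ \<beta>(1)]) (use l in simp)
  have frac: "real n / (real n - 1) \<le> 2" using n by (simp add: field_simps)
  \<comment> \<open>In this range \<open>\<beta> * k \<le> 4\<close>, so the quadratic term is at
    most linear and the exponent is at most \<open>2 * k + 2 * l\<close>. With
    \<open>ln k \<ge> 7\<close> one has \<open>ln (fact k) \<ge> 6 * k\<close>, leaving
    \<open>2 * l - 4 * k\<close>, which is below \<open>- 2 * l\<close> because
    \<open>k > l\<close>.\<close>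
  have small: "h k \<le> - 2 * l" if k: "l < real k" "real k \<le> real n / l" for k
  proof -
    have k0: "real k > 0" using k l by simp
    have "\<beta> * real k \<le> 2 * l / (real n - 1) * (real n / l)"
      using \<beta>(2) \<beta>0 k k0 l n1 by (intro mult_mono) auto
    also have "\<dots> = 2 * (real n / (real n - 1))" using l by simp
    finally have b1: "\<beta> * real k * real k \<le> 4 * real k"
      using frac k0 by (intro mult_right_mono) auto
    have "\<beta> * real n \<le> 2 * l / (real n - 1) * real n" using \<beta>(2) by (intro mult_right_mono) auto
    also have "\<dots> = 2 * l * (real n / (real n - 1))" by simp
    also have "\<dots> \<le> 2 * l * 2" using frac l by (intro mult_left_mono) auto
    finally have b2: "\<beta> * real n \<le> 4 * l" by simp
    have "\<beta> * (real k * (real k - 1) + (real n - real k)) = \<beta> * real k * real k + \<beta> * real n - 2 * (\<beta> * real k)"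
      by (simp add: algebra_simps)
    also have "\<dots> \<le> 4 * real k + 4 * l" using b1 b2 mult_nonneg_nonneg[OF \<beta>0, of "real k"] by linarith
    finally have "h k \<le> 2 * real k + 2 * l - ln (fact k)" unfolding h_def by simp
    moreover have "real k * ln (real k) - real k \<le> ln (fact k)"
      using k0 by (intro ln_fact_bounds(1)) simp
    moreover have "real k * 7 \<le> real k * ln (real k)"
    proof (intro mult_left_mono)
      have "ln l \<le> ln (real k)" using k l k0 by (intro ln_mono) auto
      then show "7 \<le> ln (real k)" using ll unfolding l_def by simp
    qed simp
    ultimately show ?thesis using k by linarith
  qed
  have hn: "h n = - 3 * l"
  proof -
    have "\<beta> * (real n * (real n - 1) / 2) = ln (fact n) - 3 * l"
      unfolding \<beta>_def critical_exponent_def real_choose_2 l_def using n1 by simp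
    then show ?thesis unfolding h_def by (simp add: field_simps)
  qed
  \<comment> \<open>The two ranges meet near \<open>n / l\<close>; \<open>gap\<close> puts
    \<open>k1\<close> above \<open>l\<close>, so that \<open>small\<close> also covers the left
    endpoint of the convex range.\<close>
  define k1 where "k1 = nat \<lfloor>real n / l\<rfloor>"
  have k1: "real k1 \<le> real n / l" "real n / l < real k1 + 1"
    using l n1 unfolding k1_def by (auto simp: of_nat_nat)
  then have k1l: "l < real k1" using gap unfolding l_def by linarith
  \<comment> \<open>The second difference is \<open>\<beta> - ln ((k + 2) / (k + 1))\<close>, at
    least \<open>\<beta> - 1 / (k + 1)\<close>. This is nonnegative as soon as
    \<open>k + 1 \<ge> n / l\<close>, because \<open>\<beta> \<ge> l / n\<close>.\<close>
  have conv: "h (Suc k) - h k \<le> h (Suc (Suc k)) - h (Suc k)" if k: "k1 \<le> k" for k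
  proof -
    have step: "h (Suc k) - h k = \<beta> * (2 * real k - 1) / 2 - ln (real k + 1)" for k
    proof -
      have "ln (fact (Suc k) :: real) = ln (real (Suc k)) + ln (fact k)"
        by (simp only: fact_Suc of_nat_mult ln_mult_pos fact_gt_zero of_nat_0_less_iff zero_less_Suc)
      then show ?thesis unfolding h_def by (simp add: field_simps del: fact_Suc)
    qed
    have k': "real n / l \<le> real k + 1" using k1(2) k by linarith
    have "ln (real (Suc k) + 1) - ln (real k + 1) = ln (1 + 1 / (real k + 1))"
    proof -
      have "(real (Suc k) + 1) / (real k + 1) = 1 + 1 / (real k + 1)" by (simp add: field_simps)
      then show ?thesis using ln_divide_pos[of "real (Suc k) + 1" "real k + 1"] by simp
    qed
    also have "\<dots> \<le> 1 / (real k + 1)" by (intro ln_add_one_self_le_self) auto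
    also have "\<dots> \<le> 1 / (real n / l)" using k' l n1 by (intro divide_left_mono) auto
    also have "\<dots> \<le> \<beta>" using \<beta>(1) by simp
    finally show ?thesis unfolding step by (simp add: field_simps)
  qed
  have "h k \<le> - 2 * l"
  proof (cases "k \<le> k1")
    case True
    then have "real k \<le> real n / l" using k1(1) by linarith
    then show ?thesis using k unfolding l_def[symmetric] by (intro small) auto
  next
    case False
    then have "h k \<le> max (h k1) (h n)" using k by (intro discrete_convex_le_max[where a = k1] conv) auto
    also have "\<dots> \<le> - 2 * l" using small[OF k1l k1(1)] hn l by simp
    finally show ?thesis .
  qed
  then show ?thesis unfolding h_def \<beta>_def l_def .
qed

lemma fact_four_quotient:
  assumes "n \<ge> 4"
  shows "real (n ^ 4 * fact (n - 4)) / fact n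
    = real n ^ 3 / ((real n - 1) * (real n - 2) * (real n - 3))"
proof -
  obtain k where "n = 4 + k" using assms le_Suc_ex by blast
  then have k: "n = Suc (Suc (Suc (Suc k)))" by simp
  have f: "fact n = real n * ((real n - 1) * (real n - 2) * (real n - 3)) * fact (n - 4)"
    unfolding k by (simp add: algebra_simps)
  show ?thesis unfolding f using assms
    by (simp add: power4_eq_xxxx power3_eq_cube)
qed

text \<open>The choice is \<open>K = ln n\<close> and \<open>J = n powr (2/3)\<close>. The exponent
  is about \<open>2 * ln n / n\<close>, so the first term tends to 1 if \<open>J\<close> is
  \<open>o(n / ln n)\<close>, and the second is of order \<open>n / J ^ 2\<close>, which tends to 0
  if \<open>J\<close> grows faster than the square root of \<open>n\<close>. The third is at most
  \<open>(n + 1) / n ^ 2\<close>.\<close>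

lemma sum_exp_fixed_edges_bound:
  "\<exists>U. U \<longlonglongrightarrow> 1 \<and> (\<forall>\<^sub>F n in sequentially.
     (\<Sum>p | p permutes {1..n}. exp (critical_exponent n * real (card (fixed_edges n p)))) / fact n \<le> U n)"
proof (intro exI conjI)
  let ?l = "\<lambda>n. ln (real n)" and ?J = "\<lambda>n. real n powr (2/3)"
  let ?U = "\<lambda>n. exp (?l n / (real n - 1) * ((?l n)\<^sup>2 + ?J n))
      + real n ^ 3 / ((real n - 1) * (real n - 2) * (real n - 3)) / (?J n * (?J n - 2))
          * exp (?l n / (real n - 1) * ((?l n)\<^sup>2 + real n))
      + (real n + 1) * exp (- 2 * ?l n)"
  show "?U \<longlonglongrightarrow> 1" by real_asymp
  have ev: "\<forall>\<^sub>F n in sequentially. real n * ?l n \<ge> 2 * real n + 6 * ?l n"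
    "\<forall>\<^sub>F n in sequentially. ln (?l n) \<ge> 7"
    "\<forall>\<^sub>F n in sequentially. real n / ?l n > ?l n + 1"
    "\<forall>\<^sub>F n in sequentially. ?J n > 2"
    by real_asymp+
  show "\<forall>\<^sub>F n in sequentially.
     (\<Sum>p | p permutes {1..n}. exp (critical_exponent n * real (card (fixed_edges n p)))) / fact n \<le> ?U n"
    using ev eventually_ge_at_top[of 4]
  proof eventually_elim
    case (elim n)
    let ?\<beta> = "critical_exponent n"
    have n: "n \<ge> 2" "n \<ge> 4" using elim by auto
    have \<beta>: "?l n / real n \<le> ?\<beta>" "?\<beta> \<le> 2 * ?l n / (real n - 1)"
      using critical_exponent_bounds[OF n(1) elim(1)] by auto
    have \<beta>0: "?\<beta> \<ge> 0" by (rule order_trans[OF _ \<beta>(1)]) (use n in simp)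
    have e: "exp (?\<beta> * b / 2) \<le> exp (?l n / (real n - 1) * b)" if "b \<ge> 0" for b
      using mult_right_mono[OF \<beta>(2) that] by (simp add: mult_ac)
    have tail: "(\<Sum>k | k \<le> n \<and> ?l n < real k. exp (?\<beta> * (real k * (real k - 1) + (real n - real k)) / 2) / fact k)
        \<le> (real n + 1) * exp (- 2 * ?l n)"
    proof -
      have "(\<Sum>k | k \<le> n \<and> ?l n < real k. exp (?\<beta> * (real k * (real k - 1) + (real n - real k)) / 2) / fact k)
          \<le> (\<Sum>k | k \<le> n \<and> ?l n < real k. exp (- 2 * ?l n))"
      proof (rule sum_mono)
        fix k assume k: "k \<in> {k. k \<le> n \<and> ?l n < real k}"
        have "exp (?\<beta> * (real k * (real k - 1) + (real n - real k)) / 2) / fact k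
           = exp (?\<beta> * (real k * (real k - 1) + (real n - real k)) / 2 - ln (fact k))"
          by (simp add: exp_diff)
        also have "\<dots> \<le> exp (- 2 * ?l n)"
          using fixed_points_exponent_le[OF n(1) elim(1,2,3)] k by (simp only: exp_le_cancel_iff mem_Collect_eq)
        finally show "exp (?\<beta> * (real k * (real k - 1) + (real n - real k)) / 2) / fact k \<le> exp (- 2 * ?l n)" .
      qed
      also have "\<dots> \<le> (\<Sum>k\<le>n. exp (- 2 * ?l n))" by (intro sum_mono2) auto
      finally show ?thesis by (simp add: add.commute)
    qed
    have "(\<Sum>p | p permutes {1..n}. exp (?\<beta> * real (card (fixed_edges n p)))) / fact n
      \<le> exp (?\<beta> * ((?l n)\<^sup>2 + ?J n) / 2)
      + real (n ^ 4 * fact (n - 4)) / fact n / (?J n * (?J n - 2)) * exp (?\<beta> * ((?l n)\<^sup>2 + real n) / 2)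
      + (\<Sum>k | k \<le> n \<and> ?l n < real k. exp (?\<beta> * (real k * (real k - 1) + (real n - real k)) / 2) / fact k)"
      using n elim by (intro sum_exp_fixed_edges_le \<beta>0) auto
    also have "\<dots> \<le> ?U n"
      unfolding fact_four_quotient[OF n(2)]
      using tail elim n by (intro add_mono mult_left_mono e) auto
    finally show ?case .
  qed
qed

section \<open>Probabilities as counts\<close>

lemma prob_Collect_not: "measure_pmf.prob p {x. \<not> A x} = 1 - measure_pmf.prob p {x. A x}"
proof -
  have "{x. \<not> A x} = space (measure_pmf p) - {x. A x}" by auto
  then show ?thesis by (simp only: measure_pmf.prob_compl sets_measure_pmf UNIV_I)
qed

lemma prob_random_colorings:
  assumes C: "finite C" "C \<noteq> {}"
  shows "measure_pmf.prob (random_colorings m n C) {\<kappa>. A \<kappa>}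
    = real (card {\<kappa> \<in> coloring_tuples m n C. A \<kappa>}) / real (card (coloring_tuples m n C))"
proof -
  let ?B = "edge_colorings n C"
  have B: "finite ?B" "?B \<noteq> {}"
    unfolding edge_colorings_def using C finite_K_edges[of n] by (auto simp: PiE_eq_empty_iff intro: finite_PiE)
  have "PiE_dflt {1..m} undefined (\<lambda>_. ?B) = coloring_tuples m n C"
    unfolding PiE_dflt_def coloring_tuples_def PiE_def Pi_def extensional_def by auto
  then have "random_colorings m n C = pmf_of_set (coloring_tuples m n C)"
    unfolding random_colorings_def using B by (subst Pi_pmf_of_set) auto
  moreover have "finite (coloring_tuples m n C)" using C(1) by (rule finite_coloring_tuples)
  moreover have "coloring_tuples m n C \<noteq> {}"
    unfolding coloring_tuples_def using B by (auto simp: PiE_eq_empty_iff)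
  moreover have "coloring_tuples m n C \<inter> {\<kappa>. A \<kappa>} = {\<kappa> \<in> coloring_tuples m n C. A \<kappa>}" by auto
  ultimately show ?thesis by (simp add: measure_pmf_of_set)
qed

section \<open>Part (i): the first moment\<close>

text \<open>A common permutation of all coordinates preserves rainbow stackings, so the first coordinate
  may be taken to be the identity.\<close>

lemma card_rainbow_stacking_exists_le:
  assumes m: "m \<ge> 1" and C: "finite C" "card C = r" "r \<ge> 1"
  shows "real (card {\<kappa> \<in> coloring_tuples m n C. \<exists>\<sigma>. rainbow_stacking m n \<kappa> \<sigma>})
    \<le> fact n ^ (m - 1) * exp (- (real (n choose 2) * (real m * (real m - 1)) / (2 * real r)))
      * real (card (coloring_tuples m n C))"
proof -
  let ?\<Omega> = "coloring_tuples m n C" and ?P = "{p. p permutes {1..n}}"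
  define T where "T = (\<Pi>\<^sub>E i\<in>{1..m}. if i = 1 then {id} else ?P)"
  have TS: "T \<subseteq> stackings m n"
    unfolding T_def stackings_def by (intro PiE_mono) (auto simp: permutes_id)
  have finT: "finite T" using TS finite_stackings by (rule finite_subset)
  have cardT: "card T = fact n ^ (m - 1)"
  proof -
    have "card T = (\<Prod>i\<in>{1..m}. card (if i = 1 then {id} else ?P))"
      unfolding T_def by (simp add: card_PiE)
    also have "\<dots> = (\<Prod>i\<in>{1..m} - {1}. fact n)"
      using m by (subst prod.remove[of _ 1]) (auto simp: card_permutations intro!: prod.cong)
    finally show ?thesis using m by simp
  qed
  have "{\<kappa> \<in> ?\<Omega>. \<exists>\<sigma>. rainbow_stacking m n \<kappa> \<sigma>} \<subseteq> (\<Union>\<sigma>\<in>T. {\<kappa> \<in> ?\<Omega>. rainbow_stacking m n \<kappa> \<sigma>})"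
  proof safe
    fix \<kappa> \<sigma> assume \<kappa>: "\<kappa> \<in> ?\<Omega>" and rb: "rainbow_stacking m n \<kappa> \<sigma>"
    have \<sigma>: "\<sigma> \<in> stackings m n" using rb unfolding rainbow_stacking_def stackings_def by blast
    note p = stackings_permutes[OF \<sigma>] and rb' = rb[unfolded rainbow_stacking_iff[OF \<sigma>]]
    have p1: "\<sigma> 1 permutes {1..n}" using m by (intro p) auto
    define \<tau> where "\<tau> = (\<lambda>i\<in>{1..m}. inv (\<sigma> 1) \<circ> \<sigma> i)"
    have \<tau>: "\<tau> \<in> T"
      unfolding T_def \<tau>_def using p p1 permutes_inv_o[OF p1]
      by (auto simp: PiE_iff intro!: permutes_compose permutes_inv)
    have "rainbow_stacking m n \<kappa> \<tau>"
      unfolding rainbow_stacking_iff[OF subsetD[OF TS \<tau>]]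
    proof (intro ballI impI)
      fix i j x y assume ij: "i \<in> {1..m}" "j \<in> {1..m}" and xy: "x \<in> K_edges n" "y \<in> K_edges n"
        and eq: "i \<noteq> j \<and> \<tau> i ` x = \<tau> j ` y"
      have "inv (\<sigma> 1) ` \<sigma> i ` x = inv (\<sigma> 1) ` \<sigma> j ` y"
        using eq ij unfolding \<tau>_def by (simp add: image_comp)
      then have "\<sigma> 1 ` inv (\<sigma> 1) ` \<sigma> i ` x = \<sigma> 1 ` inv (\<sigma> 1) ` \<sigma> j ` y" by (rule arg_cong)
      then have "\<sigma> i ` x = \<sigma> j ` y" unfolding image_inv_permutes(1)[OF p1] .
      then show "\<kappa> i x \<noteq> \<kappa> j y"
        using eq by (intro rb'[rule_format, OF ij xy]) simp
    qed
    then show "\<kappa> \<in> (\<Union>\<sigma>\<in>T. {\<kappa> \<in> ?\<Omega>. rainbow_stacking m n \<kappa> \<sigma>})" using \<tau> \<kappa> by blast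
  qed
  then have "card {\<kappa> \<in> ?\<Omega>. \<exists>\<sigma>. rainbow_stacking m n \<kappa> \<sigma>} \<le> card (\<Union>\<sigma>\<in>T. {\<kappa> \<in> ?\<Omega>. rainbow_stacking m n \<kappa> \<sigma>})"
    using finT finite_coloring_tuples[OF C(1), of m n] by (intro card_mono) auto
  also have "\<dots> \<le> (\<Sum>\<sigma>\<in>T. card {\<kappa> \<in> ?\<Omega>. rainbow_stacking m n \<kappa> \<sigma>})" using finT by (rule card_UN_le)
  also have "\<dots> = (\<Sum>\<sigma>\<in>T. (\<Prod>l<m. r - l) ^ (n choose 2))"
    using card_rainbow_eq[OF subsetD[OF TS] C(1)] C(2) by (intro sum.cong) auto
  also have "\<dots> = fact n ^ (m - 1) * (\<Prod>l<m. r - l) ^ (n choose 2)" by (simp add: cardT)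
  finally have "real (card {\<kappa> \<in> ?\<Omega>. \<exists>\<sigma>. rainbow_stacking m n \<kappa> \<sigma>})
      \<le> real (fact n ^ (m - 1) * (\<Prod>l<m. r - l) ^ (n choose 2))" by (simp only: of_nat_le_iff)
  also have "\<dots> = fact n ^ (m - 1) * (\<Prod>l<m. real (r - l)) ^ (n choose 2)" by simp
  also have "\<dots> \<le> fact n ^ (m - 1) * (\<Prod>l<m. real r * exp (- (real l / real r))) ^ (n choose 2)"
  proof (intro mult_left_mono power_mono prod_mono conjI)
    fix l
    \<comment> \<open>This is \<open>1 - t \<le> exp (- t)\<close>. Fewer colors than coordinates
      are allowed here; for \<open>l > r\<close> truncated subtraction makes the left side
      zero.\<close>
    show "real (r - l) \<le> real r * exp (- (real l / real r))"
    proof (cases "l \<le> r")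
      case True
      have "real (r - l) = real r * (1 + - (real l / real r))"
        using True C by (simp add: field_simps of_nat_diff)
      also have "\<dots> \<le> real r * exp (- (real l / real r))"
        by (intro mult_left_mono exp_ge_add_one_self) auto
      finally show ?thesis .
    qed simp
  qed (auto intro!: prod_nonneg)
  also have "(\<Prod>l<m. real r * exp (- (real l / real r))) = real r ^ m * exp (- (real m * (real m - 1) / (2 * real r)))"
  proof -
    have S: "(\<Sum>l<m. real l) = real m * (real m - 1) / 2"
      by (induction m) (auto simp: field_simps)
    have "(\<Sum>l<m. - (real l / real r)) = - ((\<Sum>l<m. real l) / real r)"
      by (simp add: sum_negf sum_divide_distrib)
    then have "(\<Sum>l<m. - (real l / real r)) = - (real m * (real m - 1) / (2 * real r))"
      unfolding S by simp
    then show ?thesis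
      by (simp add: prod.distrib exp_sum[symmetric])
  qed
  also have "(real r ^ m * exp (- (real m * (real m - 1) / (2 * real r)))) ^ (n choose 2)
      = real (card ?\<Omega>) * exp (- (real (n choose 2) * (real m * (real m - 1)) / (2 * real r)))"
    unfolding card_coloring_tuples C(2)
    by (simp add: power_mult_distrib exp_of_nat_mult[symmetric] mult.commute flip: power_mult)
  finally show ?thesis by (simp add: mult_ac)
qed

lemma ln_fact_ge_half:
  assumes "ln (real n) \<ge> 2"
  shows "real n * ln (real n) / 2 \<le> ln (fact n)"
proof -
  have "n \<ge> 1" using assms by (cases n) auto
  moreover have "real n * 2 \<le> real n * ln (real n)" using assms by (intro mult_left_mono) auto
  ultimately show ?thesis using ln_fact_bounds(1)[of n] by linarith
qed

text \<open>The logarithm of the union bound is \<open>(m - 1) * (L - N * m / (2 * R))\<close>,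
  which vanishes at \<open>r\<^sub>0\<close>. Lowering \<open>R\<close> by
  \<open>\<omega> / l\<^sup>2\<close> lowers the bracket by at least \<open>\<omega> / m\<close>,
  since \<open>l\<^sup>2 * R \<le> m * L\<close>; this explains the scale
  \<open>1 / (ln n) ^ 2\<close> of the window. Finally
  \<open>(m - 1) / m \<ge> 1 / 2\<close>.\<close>

lemma no_rainbow_stacking_whp:
  fixes C :: "nat \<Rightarrow> 'c set"
  assumes m: "m \<ge> 2"
    and \<omega>: "filterlim \<omega> at_top sequentially"
    and r: "\<And>n. n \<ge> 1 \<Longrightarrow> r n \<ge> 1"
    and C: "\<And>n. n \<ge> 1 \<Longrightarrow> finite (C n) \<and> card (C n) = r n"
    and r_le: "\<And>n. n \<ge> 2 \<Longrightarrow> real (r n) \<le> real m * real (n choose 2) / (2 * ln (fact n))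
                 - \<omega> n / (ln (real n))\<^sup>2"
  shows "with_high_probability (\<lambda>n. random_colorings m n (C n))
           (\<lambda>n \<kappa>. \<not> (\<exists>\<sigma>. rainbow_stacking m n \<kappa> \<sigma>))"
  unfolding with_high_probability_def
proof (rule tendsto_sandwich[OF _ _ _ tendsto_const])
  have "filterlim (\<lambda>n. - (\<omega> n / 2)) at_bot sequentially"
    using filterlim_tendsto_pos_mult_at_top[OF tendsto_const, of "1 / 2", OF _ \<omega>]
    by (simp add: filterlim_uminus_at_bot)
  then have "(\<lambda>n. exp (- (\<omega> n / 2))) \<longlonglongrightarrow> 0" by (rule filterlim_compose[OF exp_at_bot])
  then have "(\<lambda>n. 1 - exp (- (\<omega> n / 2))) \<longlonglongrightarrow> 1 - 0" by (intro tendsto_intros)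
  then show "(\<lambda>n. 1 - exp (- (\<omega> n / 2))) \<longlonglongrightarrow> 1" by simp
  have "\<forall>\<^sub>F n in sequentially. ln (real n) \<ge> 2" by real_asymp
  moreover have "\<forall>\<^sub>F n in sequentially. \<omega> n \<ge> 0" using \<omega> by (simp add: filterlim_at_top)
  ultimately show "\<forall>\<^sub>F n in sequentially. 1 - exp (- (\<omega> n / 2))
      \<le> measure_pmf.prob (random_colorings m n (C n)) {\<kappa>. \<not> (\<exists>\<sigma>. rainbow_stacking m n \<kappa> \<sigma>)}"
    using eventually_ge_at_top[of 2]
  proof eventually_elim
    case (elim n)
    define l L N R where "l = ln (real n)" and "L = ln (fact n :: real)"
      and "N = real (n choose 2)" and "R = real (r n)"
    have n: "n \<ge> 2" and l: "l \<ge> 2" using elim unfolding l_def by auto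
    have Cn: "finite (C n)" "card (C n) = r n" "r n \<ge> 1" using C[of n] r[of n] n by auto
    have N: "0 < N" "N \<le> real n * real n / 2"
      unfolding N_def real_choose_2 using n by (auto simp: mult_left_mono)
    have L: "real n * l / 2 \<le> L" using elim(1) unfolding l_def L_def by (intro ln_fact_ge_half)
    have L0: "L > 0" using L n l by (smt (verit) divide_pos_pos mult_pos_pos of_nat_0_less_iff zero_less_numeral less_le_trans)
    have R: "R \<ge> 1" using Cn unfolding R_def by simp
    have mm: "real m \<ge> 2" using m by simp
    have key: "L - N * real m / (2 * R) \<le> - (\<omega> n / real m)"
    proof -
      have w: "0 \<le> \<omega> n / l\<^sup>2" using elim by simp
      have le: "R + \<omega> n / l\<^sup>2 \<le> real m * N / (2 * L)"
        using r_le[OF n] unfolding R_def N_def L_def l_def by simp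
      have "(R + \<omega> n / l\<^sup>2) * (2 * L) \<le> real m * N"
        using le L0 by (simp add: pos_le_divide_eq)
      then have "L - N * real m / (2 * R) \<le> - (L * (\<omega> n / l\<^sup>2) / R)"
        using R by (simp add: field_simps)
      moreover have "\<omega> n / real m \<le> L * (\<omega> n / l\<^sup>2) / R"
      proof -
        have LN: "l\<^sup>2 * N \<le> 2 * L\<^sup>2"
        proof -
          have "l\<^sup>2 * N \<le> l\<^sup>2 * (real n * real n / 2)" using N by (intro mult_left_mono) auto
          also have "\<dots> = 2 * (real n * l / 2)\<^sup>2" by (simp add: power2_eq_square)
          also have "\<dots> \<le> 2 * L\<^sup>2" using L l by (intro mult_left_mono power_mono) auto
          finally show ?thesis .
        qed
        have "R * (2 * L) \<le> real m * N"
          using le w L0 by (simp add: pos_le_divide_eq[symmetric])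
        then have "l\<^sup>2 * (R * (2 * L)) \<le> l\<^sup>2 * (real m * N)" by (intro mult_left_mono) auto
        also have "\<dots> \<le> real m * (2 * L\<^sup>2)" using LN mm by (simp add: mult_left_mono mult.left_commute)
        finally have "2 * L * (l\<^sup>2 * R) \<le> 2 * L * (real m * L)" by (simp add: power2_eq_square mult_ac)
        then have "l\<^sup>2 * R \<le> real m * L" using L0 by simp
        then have "\<omega> n * (l\<^sup>2 * R) \<le> \<omega> n * (real m * L)" using elim by (intro mult_left_mono)
        then show ?thesis using l R mm by (simp add: field_simps)
      qed
      ultimately show ?thesis by linarith
    qed
    have exponent: "(real m - 1) * L - N * (real m * (real m - 1)) / (2 * R) \<le> - (\<omega> n / 2)"
    proof -
      have "(real m - 1) * L - N * (real m * (real m - 1)) / (2 * R) = (real m - 1) * (L - N * real m / (2 * R))"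
        by (simp add: right_diff_distrib mult_ac)
      also have "\<dots> \<le> (real m - 1) * - (\<omega> n / real m)" using key mm by (intro mult_left_mono) auto
      also have "\<dots> \<le> - (\<omega> n / 2)"
      proof -
        have "\<omega> n * real m \<le> \<omega> n * (2 * (real m - 1))" using elim mm by (intro mult_left_mono) auto
        then show ?thesis using mm by (simp add: field_simps)
      qed
      finally show ?thesis .
    qed
    let ?\<Omega> = "coloring_tuples m n (C n)"
    have "measure_pmf.prob (random_colorings m n (C n)) {\<kappa>. \<exists>\<sigma>. rainbow_stacking m n \<kappa> \<sigma>}
        \<le> fact n ^ (m - 1) * exp (- (N * (real m * (real m - 1)) / (2 * R)))"
    proof -
      have "C n \<noteq> {}" using Cn by auto
      moreover have "real (card ?\<Omega>) > 0" unfolding card_coloring_tuples Cn(2) using Cn(3) by simp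
      ultimately show ?thesis
        using card_rainbow_stacking_exists_le[of m "C n" "r n" n] Cn m
        unfolding N_def R_def by (simp add: prob_random_colorings pos_divide_le_eq)
    qed
    also have "fact n ^ (m - 1) = exp ((real m - 1) * L)"
    proof -
      have "(real m - 1) * L = real (m - 1) * L" using m by (simp add: of_nat_diff)
      then have "exp ((real m - 1) * L) = exp L ^ (m - 1)" by (simp only: exp_of_nat_mult)
      then show ?thesis unfolding L_def by simp
    qed
    also have "exp ((real m - 1) * L) * exp (- (N * (real m * (real m - 1)) / (2 * R))) \<le> exp (- (\<omega> n / 2))"
      using exponent by (simp add: exp_add[symmetric])
    finally have "measure_pmf.prob (random_colorings m n (C n)) {\<kappa>. \<exists>\<sigma>. rainbow_stacking m n \<kappa> \<sigma>} \<le> exp (- (\<omega> n / 2))" .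
    then show ?case unfolding prob_Collect_not by linarith
  qed
qed (simp add: measure_pmf.prob_le_1)

section \<open>Part (ii): the second moment above the threshold\<close>

text \<open>With \<open>r\<^sub>0 = m * N / (2 * ln (fact n))\<close>, this is the only place where the second-order term
  \<open>(2 * m - 1) / 3\<close> of the threshold is used.\<close>

lemma weight_le_critical_exponent:
  fixes r r0 :: real
  assumes m: "m \<ge> 2" and n: "n \<ge> 2" and l: "ln (real n) \<ge> 24 * real m"
    and r0: "r0 = real m * real (n choose 2) / (2 * ln (fact n))" "r0 \<ge> (real m)\<^sup>2"
    and r: "r \<ge> r0 + (2 * real m - 1) / 3"
  shows "(1 / r + 1 / (r - (real m - 1))) / 2 * real m / 2 \<le> critical_exponent n"
proof -
  \<comment> \<open>Here \<open>\<eta> = m - 1 - \<delta>\<close>, so the two denominators are at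
    least \<open>r0 + \<delta>\<close> and \<open>r0 - \<eta>\<close>; the gain comes from
    \<open>\<delta> - \<eta> = (m + 1) / 3 \<ge> 1\<close>.\<close>
  define \<delta> \<eta> N L where "\<delta> = (2 * real m - 1) / 3" and "\<eta> = (real m - 2) / 3"
    and "N = real (n choose 2)" and "L = ln (fact n :: real)"
  have mm: "real m \<ge> 2" using m by simp
  have \<delta>\<eta>: "\<delta> \<ge> 0" "\<eta> \<ge> 0" "\<delta> - \<eta> \<ge> 1" "\<delta> \<le> real m" "\<eta> \<le> real m / 3" "\<delta> \<le> 2 * real m / 3"
    unfolding \<delta>_def \<eta>_def using mm by (auto simp: field_simps)
  have "2 * real m \<le> (real m)\<^sup>2" using mm by (simp add: power2_eq_square)
  then have r0m: "r0 \<ge> 2 * real m" "r0 \<ge> (real m)\<^sup>2" using r0(2) by auto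
  have pos: "r0 > 0" "r0 - \<eta> > 0" "r0 + \<delta> > 0" using r0m mm \<delta>\<eta> by auto
  have N: "N > 0" "N \<le> real n * real n / 2"
    unfolding N_def real_choose_2 using n by (auto simp: mult_left_mono)
  have L: "real n * ln (real n) / 2 \<le> L" unfolding L_def using l mm by (intro ln_fact_ge_half) linarith
  have L0: "L > 0"
  proof -
    have "real n * ln (real n) > 0" using n l mm by (intro mult_pos_pos) auto
    then show ?thesis using L by linarith
  qed
  have "1 / r + 1 / (r - (real m - 1)) \<le> 1 / (r0 + \<delta>) + 1 / (r0 - \<eta>)"
  proof (intro add_mono divide_left_mono mult_pos_pos)
    show "r0 + \<delta> \<le> r" "r0 - \<eta> \<le> r - (real m - 1)"
      using r mm unfolding \<delta>_def \<eta>_def by (auto simp: field_simps)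
    then show "r > 0" "r - (real m - 1) > 0" using pos by auto
  qed (use pos in auto)
  \<comment> \<open>To second order the left side is
    \<open>2 / r0 - (\<delta> - \<eta>) / r0\<^sup>2\<close>. Half of the gain absorbs the term with
    \<open>\<delta> * \<eta>\<close>, using \<open>r0 \<ge> m\<^sup>2\<close>, and the bound
    \<open>2 * r0\<^sup>2\<close> on the denominator halves it again.\<close>
  also have "\<dots> \<le> 2 / r0 - 1 / (4 * r0\<^sup>2)"
  proof -
    have "\<delta> * \<eta> \<le> (2 * real m / 3) * (real m / 3)" using \<delta>\<eta> by (intro mult_mono) auto
    also have "\<dots> \<le> r0 / 4" using r0m by (simp add: power2_eq_square)
    finally have de: "2 * (\<delta> * \<eta>) \<le> r0 / 2" by simp
    have "r0 * 1 \<le> r0 * (\<delta> - \<eta>)" using \<delta>\<eta> pos by (intro mult_left_mono) auto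
    then have num: "r0 / 2 \<le> r0 * (\<delta> - \<eta>) - 2 * (\<delta> * \<eta>)" using de by linarith
    have den: "(r0 + \<delta>) * (r0 - \<eta>) \<le> (2 * r0) * r0" using r0m \<delta>\<eta> pos mm by (intro mult_mono) auto
    have "1 / (4 * r0\<^sup>2) = (r0 / 2) / (r0 * ((2 * r0) * r0))" using pos by (simp add: power2_eq_square)
    also have "\<dots> \<le> (r0 / 2) / (r0 * ((r0 + \<delta>) * (r0 - \<eta>)))"
      using den pos by (intro divide_left_mono mult_left_mono mult_pos_pos) auto
    also have "\<dots> \<le> (r0 * (\<delta> - \<eta>) - 2 * (\<delta> * \<eta>)) / (r0 * ((r0 + \<delta>) * (r0 - \<eta>)))"
      using num pos by (intro divide_right_mono mult_nonneg_nonneg) auto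
    also have "\<dots> = 2 / r0 - (1 / (r0 + \<delta>) + 1 / (r0 - \<eta>))"
      using pos by (simp add: divide_simps) (simp add: algebra_simps)
    finally show ?thesis by linarith
  qed
  finally have "(1 / r + 1 / (r - (real m - 1))) / 2 * real m / 2 \<le> (2 / r0 - 1 / (4 * r0\<^sup>2)) / 2 * real m / 2"
    by (intro divide_right_mono mult_right_mono) auto
  also have "\<dots> = real m / (2 * r0) - real m / (16 * r0\<^sup>2)" by (simp add: field_simps)
  also have "real m / (2 * r0) = L / N"
    unfolding r0(1) N_def[symmetric] L_def[symmetric] using N L0 mm by simp
  also have "real m / (16 * r0\<^sup>2) = L\<^sup>2 / (4 * real m * N\<^sup>2)"
    unfolding r0(1) N_def[symmetric] L_def[symmetric] using N L0 mm
    by (simp add: field_simps power2_eq_square)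
  \<comment> \<open>The claim amounts to \<open>12 * m * N * ln n \<le> L\<^sup>2\<close>. With
    \<open>N \<le> n\<^sup>2 / 2\<close> and \<open>L \<ge> n * ln n / 2\<close> it follows from
    \<open>ln n \<ge> 24 * m\<close>, the source of that constant.\<close>
  also have "L / N - L\<^sup>2 / (4 * real m * N\<^sup>2) \<le> L / N - 3 * ln (real n) / N"
  proof -
    have "12 * real m * N * ln (real n) \<le> 12 * real m * (real n * real n / 2) * ln (real n)"
      using N l mm by (intro mult_right_mono mult_left_mono) auto
    also have "\<dots> = (24 * real m) * (real n * real n * ln (real n) / 4)" by simp
    also have "\<dots> \<le> ln (real n) * (real n * real n * ln (real n) / 4)"
      using l mm by (intro mult_right_mono) auto
    also have "\<dots> = (real n * ln (real n) / 2)\<^sup>2" by (simp add: power2_eq_square)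
    also have "\<dots> \<le> L\<^sup>2" using L l mm by (intro power_mono) auto
    finally have "3 * ln (real n) / N \<le> L\<^sup>2 / (4 * real m * N\<^sup>2)"
      using N mm by (simp add: field_simps power2_eq_square)
    then show ?thesis by simp
  qed
  also have "\<dots> = critical_exponent n"
    unfolding critical_exponent_def N_def L_def by (simp add: diff_divide_distrib)
  finally show ?thesis .
qed

lemma rainbow_stacking_whp:
  fixes C :: "nat \<Rightarrow> 'c set"
  assumes m: "m \<ge> 2"
    and C: "\<And>n. n \<ge> 1 \<Longrightarrow> finite (C n) \<and> card (C n) = r n"
    and r_ge: "\<forall>\<^sub>F n in sequentially. real (r n) \<ge> real m * real (n choose 2) / (2 * ln (fact n))
                 + (2 * real m - 1) / 3"
  shows "with_high_probability (\<lambda>n. random_colorings m n (C n))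
           (\<lambda>n \<kappa>. \<exists>\<sigma>. rainbow_stacking m n \<kappa> \<sigma>)"
proof -
  \<comment> \<open>\<open>m * ?g n\<close> is the value of \<open>r\<^sub>0\<close> with
    \<open>ln (fact n)\<close> replaced by its upper bound \<open>n * ln n\<close>. As
    \<open>m \<ge> 2\<close>, it leaves \<open>R - 2 * m \<ge> ?g n\<close> once
    \<open>?g n \<ge> 2 * m\<close>.\<close>
  let ?g = "\<lambda>n. (real n - 1) / (4 * ln (real n))"
  obtain U where U: "U \<longlonglongrightarrow> 1" "\<forall>\<^sub>F n in sequentially.
     (\<Sum>p | p permutes {1..n}. exp (critical_exponent n * real (card (fixed_edges n p)))) / fact n \<le> U n"
    using sum_exp_fixed_edges_bound by blast
  \<comment> \<open>\<open>V n - 1\<close> will bound the probability of failure, which gives the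
    lower bound \<open>2 - V n\<close> below.\<close>
  define V where "V n = exp (2 * real m ^ 4 * (real n * (real n - 1) / 2 / ?g n ^ 3)) * U n ^ (m - 1)" for n
  have "(\<lambda>n. real n * (real n - 1) / 2 / ?g n ^ 3) \<longlonglongrightarrow> 0" by real_asymp
  then have "V \<longlonglongrightarrow> exp (2 * real m ^ 4 * 0) * 1 ^ (m - 1)"
    unfolding V_def by (intro tendsto_intros U(1))
  then have V: "(\<lambda>n. 2 - V n) \<longlonglongrightarrow> 2 - 1" by (intro tendsto_intros) simp
  have "filterlim ?g at_top sequentially" by real_asymp
  then have "\<forall>\<^sub>F n in sequentially. ?g n \<ge> 2 * real m" by (simp add: filterlim_at_top)
  moreover have "filterlim (\<lambda>n. ln (real n)) at_top sequentially" by real_asymp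
  then have "\<forall>\<^sub>F n in sequentially. ln (real n) \<ge> 24 * real m" by (simp add: filterlim_at_top)
  ultimately have lower: "\<forall>\<^sub>F n in sequentially. 2 - V n
      \<le> measure_pmf.prob (random_colorings m n (C n)) {\<kappa>. \<exists>\<sigma>. rainbow_stacking m n \<kappa> \<sigma>}"
    using r_ge U(2) eventually_ge_at_top[of 2]
  proof eventually_elim
    case (elim n)
    define r0 g N R where "r0 = real m * real (n choose 2) / (2 * ln (fact n))" and "g = ?g n"
      and "N = real (n choose 2)" and "R = real (r n)"
    have n: "n \<ge> 2" and g: "g \<ge> 2 * real m" using elim unfolding g_def by auto
    have mm: "real m \<ge> 2" using m by simp
    have l: "ln (real n) > 0" using elim(2) mm by linarith
    have L0: "ln (fact n :: real) > 0"
    proof -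
      have "real n * ln (real n) / 2 \<le> ln (fact n)" using elim(2) mm by (intro ln_fact_ge_half) linarith
      moreover have "real n * ln (real n) > 0" using l n by simp
      ultimately show ?thesis by linarith
    qed
    have N: "N > 0" "N = real n * (real n - 1) / 2" unfolding N_def real_choose_2 using n by auto
    have r0: "r0 \<ge> real m * g"
    proof -
      have "real m * g = real m * N / (2 * (real n * ln (real n)))"
        unfolding g_def N(2) using n l by (simp add: field_simps)
      also have "\<dots> \<le> r0"
        unfolding r0_def N_def[symmetric] using ln_fact_bounds(2)[of n] n L0 l mm N(1)
        by (intro divide_left_mono mult_left_mono) auto
      finally show ?thesis .
    qed
    have R: "R \<ge> r0 + (2 * real m - 1) / 3" using elim(3) unfolding R_def r0_def .
    have r02: "r0 \<ge> (real m)\<^sup>2"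
    proof -
      have "real m * real m \<le> real m * g" using g mm by (intro mult_left_mono) auto
      then show ?thesis using r0 by (simp add: power2_eq_square)
    qed
    have Rg: "R - 2 * real m \<ge> g"
    proof -
      have "2 * g \<le> real m * g" using g mm by (intro mult_right_mono) auto
      moreover have "(2 * real m - 1) / 3 \<ge> 0" using mm by simp
      ultimately show ?thesis using r0 R g by linarith
    qed
    have Cn: "finite (C n)" "card (C n) = r n" using C[of n] n by auto
    have R2: "2 * m < r n" using Rg g mm unfolding R_def by linarith
    define Q where "Q = (\<Sum>\<tau> | \<tau> permutes {1..n}. exp ((1 / R + 1 / (R - (real m - 1))) / 2 * real m / 2
              * real (card (fixed_edges n \<tau>)))) / fact n"
    have Q: "0 \<le> Q" "Q \<le> U n"
    proof -
      show "0 \<le> Q" unfolding Q_def by (intro divide_nonneg_pos sum_nonneg) auto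
      have "(1 / R + 1 / (R - (real m - 1))) / 2 * real m / 2 \<le> critical_exponent n"
        using m n elim(2) r0_def r02 R by (rule weight_le_critical_exponent)
      then have "Q \<le> (\<Sum>p | p permutes {1..n}. exp (critical_exponent n * real (card (fixed_edges n p)))) / fact n"
        unfolding Q_def
        by (intro divide_right_mono sum_mono) (simp_all only: exp_le_cancel_iff mult_right_mono of_nat_0_le_iff fact_ge_zero)
      then show "Q \<le> U n" using elim(4) by linarith
    qed
    have M: "exp (real (m * (n choose 2)) * (2 * real m ^ 3 / (R - 2 * real m) ^ 3))
        \<le> exp (2 * real m ^ 4 * (N / g ^ 3))"
    proof -
      have "2 * real m ^ 3 / (R - 2 * real m) ^ 3 \<le> 2 * real m ^ 3 / g ^ 3"
        using Rg g mm by (intro divide_left_mono power_mono mult_pos_pos zero_less_power) auto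
      then have "real (m * (n choose 2)) * (2 * real m ^ 3 / (R - 2 * real m) ^ 3)
          \<le> real (m * (n choose 2)) * (2 * real m ^ 3 / g ^ 3)" by (intro mult_left_mono) auto
      also have "\<dots> = 2 * real m ^ 4 * (N / g ^ 3)"
        unfolding N_def by (simp add: power4_eq_xxxx power3_eq_cube)
      finally show ?thesis by simp
    qed
    have V: "exp (real (m * (n choose 2)) * (2 * real m ^ 3 / (R - 2 * real m) ^ 3)) * Q ^ (m - 1) \<le> V n"
      unfolding V_def N(2)[symmetric] g_def[symmetric] using M Q by (intro mult_mono power_mono) auto
    let ?\<Omega> = "coloring_tuples m n (C n)"
    have ne: "C n \<noteq> {}" using Cn R2 by auto
    have "real (card ?\<Omega>) > 0" unfolding card_coloring_tuples Cn(2) using R2 by simp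
    then have "measure_pmf.prob (random_colorings m n (C n)) {\<kappa>. \<not> (\<exists>\<sigma>. rainbow_stacking m n \<kappa> \<sigma>)}
        \<le> exp (real (m * (n choose 2)) * (2 * real m ^ 3 / (R - 2 * real m) ^ 3)) * Q ^ (m - 1) - 1"
      unfolding prob_random_colorings[OF Cn(1) ne] Q_def R_def
      using card_no_rainbow_stacking_le[OF _ Cn R2, of n] m by (simp only: pos_divide_le_eq)
    then show ?case using V unfolding prob_Collect_not by linarith
  qed
  show ?thesis
    unfolding with_high_probability_def
  proof (rule tendsto_sandwich[OF lower _ _ tendsto_const])
    show "(\<lambda>n. 2 - V n) \<longlonglongrightarrow> 1" using V by simp
  qed (simp add: measure_pmf.prob_le_1)
qed

theorem theorem1p1:
  fixes m :: nat and \<omega> :: "nat \<Rightarrow> real" and r :: "nat \<Rightarrow> nat" and C :: "nat \<Rightarrow> 'c set"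
  assumes m: "m \<ge> 2"
    and \<omega>: "filterlim \<omega> at_top sequentially"
    and r: "\<And>n. n \<ge> 1 \<Longrightarrow> r n \<ge> 1"
    and C: "\<And>n. n \<ge> 1 \<Longrightarrow> finite (C n) \<and> card (C n) = r n"
  shows "((\<forall>n\<ge>2. real (r n) \<le> real m * real (n choose 2) / (2 * ln (fact n))
                     - \<omega> n / (ln (real n))\<^sup>2) \<longrightarrow>
           with_high_probability (\<lambda>n. random_colorings m n (C n))
             (\<lambda>n \<kappa>. \<not> (\<exists>\<sigma>. rainbow_stacking m n \<kappa> \<sigma>))) \<and>
         ((\<forall>n\<ge>2. real (r n) \<ge> real m * real (n choose 2) / (2 * ln (fact n))
                     + (2 * real m - 1) / 3 + real m / (2 * ln (real n))
                     + \<omega> n / (ln (real n))\<^sup>2) \<longrightarrow>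
           with_high_probability (\<lambda>n. random_colorings m n (C n))
             (\<lambda>n \<kappa>. \<exists>\<sigma>. rainbow_stacking m n \<kappa> \<sigma>))"
proof (intro conjI impI)
  assume "\<forall>n\<ge>2. real (r n) \<le> real m * real (n choose 2) / (2 * ln (fact n)) - \<omega> n / (ln (real n))\<^sup>2"
  then show "with_high_probability (\<lambda>n. random_colorings m n (C n))
             (\<lambda>n \<kappa>. \<not> (\<exists>\<sigma>. rainbow_stacking m n \<kappa> \<sigma>))"
    using m \<omega> r C by (intro no_rainbow_stacking_whp) auto
next
  assume r_ge: "\<forall>n\<ge>2. real (r n) \<ge> real m * real (n choose 2) / (2 * ln (fact n))
      + (2 * real m - 1) / 3 + real m / (2 * ln (real n)) + \<omega> n / (ln (real n))\<^sup>2"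
  have "\<forall>\<^sub>F n in sequentially. \<omega> n \<ge> 0" using \<omega> by (simp add: filterlim_at_top)
  then have "\<forall>\<^sub>F n in sequentially. real (r n) \<ge> real m * real (n choose 2) / (2 * ln (fact n))
                 + (2 * real m - 1) / 3"
    using eventually_ge_at_top[of 2]
  proof eventually_elim
    case (elim n)
    have "0 \<le> real m / (2 * ln (real n))" "0 \<le> \<omega> n / (ln (real n))\<^sup>2" using elim by auto
    then show ?case using r_ge[rule_format, OF elim(2)] by linarith
  qed
  then show "with_high_probability (\<lambda>n. random_colorings m n (C n)) (\<lambda>n \<kappa>. \<exists>\<sigma>. rainbow_stacking m n \<kappa> \<sigma>)"
    using m C by (intro rainbow_stacking_whp) auto
qed

end
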